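(* Let $n\ge 2$ and $p\ge 2$ be natural numbers. For every element $t$ of $\mathcal{J}_n$ the 0-1 matrix $M(t)$ assigned to $t$ has an entry equal to $1$ at a position where all the matrices $M(t')$, for $t'$ preceding $t$ in the lexicographical order of $\mathcal{J}_n$, have $0$. Hence the list of matrices $M(t)$, $t\in\mathcal{J}_n$, is linearly independent, and Brauer's representation of the Temperley-Lieb algebra $\mathcal{T}_n$ with parameter $p$ in $p^n\times p^n$ matrices is faithful (i.e. injective).
   Context: Temperley-Lieb algebra. Over a field of scalars in which $p$ is nonzero, $\mathcal{T}_n$ is the associative algebra with unit $\mathbf{1}^n$, generated by $h^n_1,\ldots,h^n_{n-1}$ subject to $h^n_ih^n_j=h^n_jh^n_i$ for $i-j\ge 2$, $h^n_ih^n_{i\pm1}h^n_i=h^n_i$, and $h^n_ih^n_i=p\,h^n_i$. Its basis $\mathcal{J}_n$ is (as a set) the monoid generated by $h^n_1,\ldots,h^n_{n-1}$ with unit $\mathbf{1}^n$ subject to the first two families of equations and $h^n_ih^n_i=h^n_i$. Blocks and normal form. $h^n_{i,0}$ is $\mathbf{1}^n$, $h^n_{i,1}$ is $h^n_i$, and for $2\le k\le i$, $h^n_{i,k}$ is $h^n_{i,k-1}h^n_{i-k+1}$. Every element of $\mathcal{J}_n$ is denoted by a unique expression in normal form $h^n_{1,k_1}\ldots h^n_{n-1,k_{n-1}}$, where $0\le k_i\le i$ for every $i$, and whenever $i<j$ and $k_i,k_j>0$ we have $i-k_i<j-k_j$. The basis element of $\mathcal{T}_n$ corresponding to it is the same product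 computed in $\mathcal{T}_n$. Lexicographical order of $\mathcal{J}_n$. The element with normal form given by $k'_1\ldots k'_{n-1}$ precedes the one given by $k_1\ldots k_{n-1}$ iff for some $i$ we have $k'_i<k_i$ and for every $j>i$ we have $k'_j=k_j$. Assigned matrices. $E_p$ is the $1\times p^2$ matrix with entries $E_p(1,(i-1)p+j)=\delta(i,j)$ for $1\le i,j\le p$ ($\delta$ is the Kronecker delta), and $E_p'$ is its transpose. To $h^n_i$, $1\le i\le n-1$, is assigned the $p^n\times p^n$ matrix $H_i=I_{p^{n-i-1}}\otimes E_p'E_p\otimes I_{p^{i-1}}$, and to $\mathbf{1}^n$ the identity matrix $I_{p^n}$ ($\otimes$ is the Kronecker product, $A\otimes B$ being the block matrix with blocks $A(a,b)B$). A 0-1 matrix $A$ is identified with the binary relation $\{(a,b)\mid A(a,b)=1\}$. With multiplication interpreted as composition of relations ($(a,c)\in xy$ iff for some $b$, $(a,b)\in x$ and $(b,c)\in y$), the relations of $I_{p^n},H_1,\ldots,H_{n-1}$ satisfy the defining equations of $\mathcal{J}_n$, so to each $t\in\mathcal{J}_n$ is assigned a binary relation on $\{1,\ldots,p^n\}$; $M(t)$ is the 0-1 matrix of this relation. Brauer's representation. With matrix multiplication, $I_{p^n},H_1,\ldots,H_{n-1}$ satisfy the defining equations of $\mathcal{T}_n$; Brauer's representation of $\mathcal{T}_n$ is the unital algebra homomorphism from $\mathcal{T}_n$ to the $p^n\times p^n$ matrices over the field of scalars sending $h^n_i$ to $H_i$ for each $i$. *)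

theory Defs
  imports "Jordan_Normal_Form.Matrix" "HOL-Algebra.QuotRing"
begin

section \<open>The monoid \<open>J\<^sub>n\<close>\<close>

text \<open>A word over the generators \<open>h\<^sub>1, \<dots>, h\<^sub>n\<^sub>-\<^sub>1\<close> is a list of indices in \<open>{1..<n}\<close>; the empty
  word is the unit and concatenation is multiplication. The rule \<open>sym\<close> together with \<open>far\<close> covers
  both orientations of the commutation relation.\<close>

inductive_set jones_cong :: "nat \<Rightarrow> (nat list \<times> nat list) set" for n :: nat where
  far: "i \<in> {1..<n} \<Longrightarrow> j \<in> {1..<n} \<Longrightarrow> j + 2 \<le> i \<Longrightarrow> ([i, j], [j, i]) \<in> jones_cong n"
| up: "i \<in> {1..<n} \<Longrightarrow> i + 1 \<in> {1..<n} \<Longrightarrow> ([i, i + 1, i], [i]) \<in> jones_cong n"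
| down: "i \<in> {1..<n} \<Longrightarrow> i + 1 \<in> {1..<n} \<Longrightarrow> ([i + 1, i, i + 1], [i + 1]) \<in> jones_cong n"
| idem: "i \<in> {1..<n} \<Longrightarrow> ([i, i], [i]) \<in> jones_cong n"
| refl: "w \<in> lists {1..<n} \<Longrightarrow> (w, w) \<in> jones_cong n"
| sym: "(u, v) \<in> jones_cong n \<Longrightarrow> (v, u) \<in> jones_cong n"
| trans: "(u, v) \<in> jones_cong n \<Longrightarrow> (v, w) \<in> jones_cong n \<Longrightarrow> (u, w) \<in> jones_cong n"
| mult: "(u, v) \<in> jones_cong n \<Longrightarrow> (u', v') \<in> jones_cong n \<Longrightarrow> (u @ u', v @ v') \<in> jones_cong n"

definition jones :: "nat \<Rightarrow> nat list set set" where
  "jones n = lists {1..<n} // jones_cong n"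

definition jones_class :: "nat \<Rightarrow> nat list \<Rightarrow> nat list set" where
  "jones_class n w = jones_cong n `` {w}"

subsection \<open>Normal forms and the lexicographical order\<close>

primrec block :: "nat \<Rightarrow> nat \<Rightarrow> nat list" where
  "block i 0 = []"
| "block i (Suc k) = block i k @ [i - k]"

definition nf_word :: "nat \<Rightarrow> (nat \<Rightarrow> nat) \<Rightarrow> nat list" where
  "nf_word n k = concat (map (\<lambda>i. block i (k i)) [1..<n])"

text \<open>Only the values of \<open>k\<close> on \<open>{1..<n}\<close> matter.\<close>

definition is_nf :: "nat \<Rightarrow> (nat \<Rightarrow> nat) \<Rightarrow> bool" where
  "is_nf n k \<longleftrightarrow> (\<forall>i\<in>{1..<n}. k i \<le> i) \<and>
     (\<forall>i\<in>{1..<n}. \<forall>j\<in>{1..<n}. i < j \<and> 0 < k i \<and> 0 < k j \<longrightarrow> i - k i < j - k j)"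

definition precedes :: "nat \<Rightarrow> nat list set \<Rightarrow> nat list set \<Rightarrow> bool" where
  "precedes n t' t \<longleftrightarrow> (\<exists>k' k. is_nf n k' \<and> is_nf n k \<and>
     t' = jones_class n (nf_word n k') \<and> t = jones_class n (nf_word n k) \<and>
     (\<exists>i\<in>{1..<n}. k' i < k i \<and> (\<forall>j\<in>{i<..<n}. k' j = k j)))"


section \<open>The assigned matrices\<close>

text \<open>Block matrix with blocks \<open>A(a,b) B\<close>.\<close>

definition kron :: "'a::times mat \<Rightarrow> 'a mat \<Rightarrow> 'a mat" (infixl "\<otimes>\<^sub>k" 70) where
  "A \<otimes>\<^sub>k B = mat (dim_row A * dim_row B) (dim_col A * dim_col B)
     (\<lambda>(r, c). A $$ (r div dim_row B, c div dim_col B) * B $$ (r mod dim_row B, c mod dim_col B))"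

text \<open>Indices start at \<open>0\<close> here: the entry at column \<open>i p + j\<close> with \<open>i, j < p\<close> is \<open>\<delta>(i,j)\<close>.\<close>

definition E_mat :: "nat \<Rightarrow> 'a::zero_neq_one mat" where
  "E_mat p = mat 1 (p\<^sup>2) (\<lambda>(_, c). if c div p = c mod p then 1 else 0)"

definition H_mat :: "nat \<Rightarrow> nat \<Rightarrow> nat \<Rightarrow> 'a::semiring_1 mat" where
  "H_mat n p i =
     1\<^sub>m (p ^ (n - i - 1)) \<otimes>\<^sub>k (transpose_mat (E_mat p) * E_mat p) \<otimes>\<^sub>k 1\<^sub>m (p ^ (i - 1))"

definition mat_rel :: "'a::zero_neq_one mat \<Rightarrow> (nat \<times> nat) set" where
  "mat_rel A = {(a, b). a < dim_row A \<and> b < dim_col A \<and> A $$ (a, b) = 1}"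

definition rel_mat :: "nat \<Rightarrow> (nat \<times> nat) set \<Rightarrow> 'a::zero_neq_one mat" where
  "rel_mat N R = mat N N (\<lambda>(a, b). if (a, b) \<in> R then 1 else 0)"

text \<open>The relation of a 0-1 matrix does not depend on the semiring holding its entries; the
  natural numbers are used. The relational composition \<open>(O)\<close> composes from left to right.\<close>

definition word_rel :: "nat \<Rightarrow> nat \<Rightarrow> nat list \<Rightarrow> (nat \<times> nat) set" where
  "word_rel n p w =
     foldr (\<lambda>i R. mat_rel (H_mat n p i :: nat mat) O R) w (mat_rel (1\<^sub>m (p ^ n) :: nat mat))"

text \<open>All words in a class \<open>t\<close> have the same relation, so the image of \<open>t\<close> is a singleton.\<close>

definition jones_rel :: "nat \<Rightarrow> nat \<Rightarrow> nat list set \<Rightarrow> (nat \<times> nat) set" where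
  "jones_rel n p t = the_elem (word_rel n p ` t)"

definition jones_mat :: "nat \<Rightarrow> nat \<Rightarrow> nat list set \<Rightarrow> 'a::zero_neq_one mat" where
  "jones_mat n p t = rel_mat (p ^ n) (jones_rel n p t)"

text \<open>Linear independence of a family of \<open>N \<times> N\<close> matrices (rather than of the set of its members,
  so that repetitions are excluded).\<close>

definition lin_indep_family :: "nat \<Rightarrow> 'i set \<Rightarrow> ('i \<Rightarrow> 'a::field mat) \<Rightarrow> bool" where
  "lin_indep_family N T M \<longleftrightarrow> (\<forall>S c. finite S \<and> S \<subseteq> T \<and>
     finsum (ring_mat TYPE('a) N ()) (\<lambda>t. c t \<cdot>\<^sub>m M t) S = 0\<^sub>m N N \<longrightarrow> (\<forall>t\<in>S. c t = 0))"


section \<open>The Temperley-Lieb algebra\<close>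

text \<open>The free unital algebra on \<open>h\<^sub>1, \<dots>, h\<^sub>n\<^sub>-\<^sub>1\<close>: finitely supported functions from words to
  scalars, with convolution along concatenation as product.\<close>

definition free_alg :: "nat \<Rightarrow> (nat list \<Rightarrow> 'a::field) ring" where
  "free_alg n = \<lparr>
     carrier = {f. finite {w. f w \<noteq> 0} \<and> {w. f w \<noteq> 0} \<subseteq> lists {1..<n}},
     mult = (\<lambda>f g w. \<Sum>m\<le>length w. f (take m w) * g (drop m w)),
     one = (\<lambda>w. if w = [] then 1 else 0),
     zero = (\<lambda>w. 0),
     add = (\<lambda>f g w. f w + g w)\<rparr>"

definition word_monom :: "'a::field \<Rightarrow> nat list \<Rightarrow> nat list \<Rightarrow> 'a" where
  "word_monom c w = (\<lambda>v. if v = w then c else 0)"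

definition tl_relations :: "nat \<Rightarrow> nat \<Rightarrow> (nat list \<Rightarrow> 'a::field) set" where
  "tl_relations n p =
     {word_monom 1 [i, j] \<ominus>\<^bsub>free_alg n\<^esub> word_monom 1 [j, i] | i j.
        i \<in> {1..<n} \<and> j \<in> {1..<n} \<and> j + 2 \<le> i} \<union>
     {word_monom 1 [i, j, i] \<ominus>\<^bsub>free_alg n\<^esub> word_monom 1 [i] | i j.
        i \<in> {1..<n} \<and> j \<in> {1..<n} \<and> (j = i + 1 \<or> i = j + 1)} \<union>
     {word_monom 1 [i, i] \<ominus>\<^bsub>free_alg n\<^esub> word_monom (of_nat p) [i] | i. i \<in> {1..<n}}"

text \<open>The two-sided ideal generated by the relations is closed under scalars, since scalars are
  multiples of the unit.\<close>

definition tl_ideal :: "nat \<Rightarrow> nat \<Rightarrow> (nat list \<Rightarrow> 'a::field) set" where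
  "tl_ideal n p = genideal (free_alg n) (tl_relations n p)"

definition tl_alg :: "nat \<Rightarrow> nat \<Rightarrow> (nat list \<Rightarrow> 'a::field) set ring" where
  "tl_alg n p = free_alg n Quot tl_ideal n p"

definition tl_class :: "nat \<Rightarrow> nat \<Rightarrow> (nat list \<Rightarrow> 'a::field) \<Rightarrow> (nat list \<Rightarrow> 'a) set" where
  "tl_class n p f = tl_ideal n p +>\<^bsub>free_alg n\<^esub> f"

definition tl_gen :: "nat \<Rightarrow> nat \<Rightarrow> nat \<Rightarrow> (nat list \<Rightarrow> 'a::field) set" where
  "tl_gen n p i = tl_class n p (word_monom 1 [i])"

definition tl_smult ::
  "nat \<Rightarrow> nat \<Rightarrow> 'a::field \<Rightarrow> (nat list \<Rightarrow> 'a) set \<Rightarrow> (nat list \<Rightarrow> 'a) set" where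
  "tl_smult n p c x = tl_class n p (word_monom c []) \<otimes>\<^bsub>tl_alg n p\<^esub> x"

definition is_brauer_rep ::
  "nat \<Rightarrow> nat \<Rightarrow> ((nat list \<Rightarrow> 'a::field) set \<Rightarrow> 'a mat) \<Rightarrow> bool" where
  "is_brauer_rep n p \<phi> \<longleftrightarrow>
     \<phi> \<in> ring_hom (tl_alg n p) (ring_mat TYPE('a) (p ^ n) ()) \<and>
     (\<forall>c. \<forall>x\<in>carrier (tl_alg n p). \<phi> (tl_smult n p c x) = c \<cdot>\<^sub>m \<phi> x) \<and>
     (\<forall>i\<in>{1..<n}. \<phi> (tl_gen n p i) = H_mat n p i)"

end

theory Submission
  imports Defs "HOL-Computational_Algebra.Formal_Power_Series"
    "HOL-Algebra.Multiplicative_Group"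
begin

text \<open>Write an index below \<open>p\<^sup>n\<close> as \<open>n\<close> digits in base \<open>p\<close> and an entry \<open>(x, z)\<close> of a matrix as the cyclic word
  \<open>z\<^sub>0 \<dots> z\<^sub>n\<^sub>-\<^sub>1 x\<^sub>n\<^sub>-\<^sub>1 \<dots> x\<^sub>0\<close>. The product of the matrices \<open>H\<^sub>i\<close> along a normal form is a 0-1 matrix, and its
  entry is \<open>1\<close> iff the cyclic word can be deleted by removing, for \<open>m = n - 1, \<dots>, 0\<close>, two equal letters
  at the adjacent positions \<open>m - k\<^sub>m\<close> and \<open>m - k\<^sub>m + 1\<close>. A word over \<open>{0, 1}\<close> in which each of these pairs is
  the rightmost possible one is therefore an entry of the given normal form and of no preceding one.
  This triangularity gives linear independence over the normal forms. Rewriting brings every word to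
  normal form, up to a power of \<open>p\<close> in the Temperley-Lieb algebra, so that the kernel of the
  representation of the free algebra is exactly the ideal of the relations.\<close>


text \<open>The letters of the cyclic word sit on the boundary of a planar diagram, and the removed
  pairs are its arcs, which never cross. Products of the \<open>H_mat\<close> have entries above 1
  only through closed loops, each contributing a factor p. Along a normal form every summation in
  \<open>h_act\<close> meets at most one nonzero term, so no loop arises. Hence relational
  composition, which forgets multiplicities, agrees there with matrix multiplication, and one
  combinatorial predicate describes both M(t) and the Brauer matrix. The computation runs over an
  arbitrary semiring, to be read over the naturals for relations and over the field for the algebra.
  Rewriting gives only the existence of normal forms. Their uniqueness comes back from the
  separating words, because congruent words have equal relations. Two letters suffice for separation
  since a new letter only has to differ from one given neighbour; hence p \<ge> 2.\<close>

section \<open>The action of the generators on functions of digit sequences\<close>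

text \<open>Right multiplication of a row vector, indexed by digit sequences, by \<open>H\<^sub>i\<close>.\<close>

definition h_act :: "nat \<Rightarrow> nat \<Rightarrow> ((nat \<Rightarrow> nat) \<Rightarrow> 'a) \<Rightarrow> (nat \<Rightarrow> nat) \<Rightarrow> 'a::semiring_1" where
  "h_act p i f z = (if z (i - 1) = z i then \<Sum>d<p. f (z(i - 1 := d, i := d)) else 0)"

text \<open>A row vector times a product of matrices meets the leftmost factor first, hence
  \<open>foldl\<close>.\<close>

definition word_act :: "nat \<Rightarrow> nat list \<Rightarrow> ((nat \<Rightarrow> nat) \<Rightarrow> 'a) \<Rightarrow> (nat \<Rightarrow> nat) \<Rightarrow> 'a::semiring_1" where
  "word_act p w f = foldl (\<lambda>g i. h_act p i g) f w"

lemma word_act_Nil [simp]: "word_act p [] f = f"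
  by (simp add: word_act_def)

lemma word_act_Cons [simp]: "word_act p (i # w) f = word_act p w (h_act p i f)"
  by (simp add: word_act_def)

lemma word_act_append: "word_act p (u @ v) f = word_act p v (word_act p u f)"
  by (simp add: word_act_def)

lemma h_act_idem:
  assumes "i \<ge> 1"
  shows "h_act p i (h_act p i f) = (\<lambda>z. of_nat p * h_act p i f z)"
proof
  fix z :: "nat \<Rightarrow> nat"
  have "i - 1 \<noteq> i"
    using assms by simp
  moreover from this have "z(i - 1 := d, i := d, i - 1 := e, i := e) = z(i - 1 := e, i := e)" for d e
    by (intro ext) auto
  ultimately show "h_act p i (h_act p i f) z = of_nat p * h_act p i f z"
    by (simp add: h_act_def del: One_nat_def)
qed

lemma h_act_far:
  assumes "j \<ge> 1" "j + 2 \<le> i"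
  shows "h_act p i (h_act p j f) = h_act p j (h_act p i f)"
proof
  fix z :: "nat \<Rightarrow> nat"
  have upd: "z(i - 1 := a, i := a, j - 1 := b, j := b) = z(j - 1 := b, j := b, i - 1 := a, i := a)" for a b
    using assms by (intro ext) auto
  have ne: "i - 1 \<noteq> j - 1" "i - 1 \<noteq> j" "i \<noteq> j - 1" "i \<noteq> j"
    using assms by auto
  show "h_act p i (h_act p j f) z = h_act p j (h_act p i f) z"
    using ne ne[symmetric] by (simp add: h_act_def upd del: One_nat_def) (intro impI sum.swap)
qed

text \<open>The middle generator forces the inserted digit \<open>d\<close> to equal
  \<open>z (Suc i)\<close>, and the next one forces \<open>e = d\<close>. The two outer sums thus
  keep one term each, and the innermost is the right-hand side. The surviving term lies in the range
  of summation because the digits of \<open>z\<close> are below \<open>p\<close>.\<close>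

lemma h_act_braid_up:
  assumes "i \<ge> 1" "\<And>j. z j < p"
  shows "h_act p i (h_act p (Suc i) (h_act p i f)) z = h_act p i f z"
proof -
  have 1: "h_act p (Suc i) (h_act p i f) (z(i - 1 := d, i := d)) =
      (if d = z (Suc i) then \<Sum>e<p. f (z(i - 1 := e, i := e)) else 0)" (is "?L = ?R") for d
  proof (cases "d = z (Suc i)")
    case True
    have "?L = (\<Sum>e<p. h_act p i f (z(i - 1 := d, i := e, Suc i := e)))"
      using assms True by (simp add: h_act_def)
    also have "\<dots> = (\<Sum>e<p. if e = d then \<Sum>e'<p. f (z(i - 1 := e', i := e')) else 0)"
    proof (rule sum.cong[OF HOL.refl])
      fix e :: nat
      have "z(i - 1 := d, i := d, Suc i := d, i - 1 := e', i := e') = z(i - 1 := e', i := e')" for e'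
        using assms True by (intro ext) auto
      then show "h_act p i f (z(i - 1 := d, i := e, Suc i := e)) =
          (if e = d then \<Sum>e'<p. f (z(i - 1 := e', i := e')) else 0)"
        using assms by (auto simp: h_act_def)
    qed
    also have "\<dots> = ?R"
      using assms True by simp
    finally show ?thesis .
  qed (simp add: h_act_def)
  show ?thesis
    unfolding h_act_def[of p i "h_act p (Suc i) (h_act p i f)" z] 1 h_act_def[of p i f z]
    using assms(2) by simp
qed

lemma h_act_braid_down:
  assumes "i \<ge> 1" "\<And>j. z j < p"
  shows "h_act p (Suc i) (h_act p i (h_act p (Suc i) f)) z = h_act p (Suc i) f z"
proof -
  have 1: "h_act p i (h_act p (Suc i) f) (z(i := d, Suc i := d)) =
      (if d = z (i - 1) then \<Sum>e<p. f (z(i := e, Suc i := e)) else 0)" (is "?L = ?R") for d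
  proof (cases "d = z (i - 1)")
    case True
    have "?L = (\<Sum>e<p. h_act p (Suc i) f (z(i := d, Suc i := d, i - 1 := e, i := e)))"
      using assms True by (simp add: h_act_def)
    also have "\<dots> = (\<Sum>e<p. if e = d then \<Sum>e'<p. f (z(i := e', Suc i := e')) else 0)"
    proof (rule sum.cong[OF HOL.refl])
      fix e :: nat
      have "z(i := d, Suc i := d, i - 1 := d, i := d, i := e', Suc i := e') = z(i := e', Suc i := e')" for e'
        using assms True by (intro ext) auto
      then show "h_act p (Suc i) f (z(i := d, Suc i := d, i - 1 := e, i := e)) =
          (if e = d then \<Sum>e'<p. f (z(i := e', Suc i := e')) else 0)"
        using assms by (auto simp: h_act_def)
    qed
    also have "\<dots> = ?R"
      using assms True by simp
    finally show ?thesis .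
  qed (use assms in \<open>auto simp: h_act_def\<close>)
  show ?thesis
    unfolding h_act_def[of p "Suc i" "h_act p i (h_act p (Suc i) f)" z] h_act_def[of p "Suc i" f z]
    using assms(2) by (simp add: 1)
qed


section \<open>Matrix entries of normal forms\<close>

definition remove_pair :: "nat \<Rightarrow> (nat \<Rightarrow> nat) \<Rightarrow> nat \<Rightarrow> nat" where
  "remove_pair s W j = (if j < s then W j else W (j + 2))"

definition insert_pair :: "nat \<Rightarrow> nat \<Rightarrow> (nat \<Rightarrow> nat) \<Rightarrow> nat \<Rightarrow> nat" where
  "insert_pair s c W j = (if j < s then W j else if j < s + 2 then c else W (j - 2))"

text \<open>The two digits of index \<open>n - 1\<close> become neighbours in the middle, so an
  undisturbed strand is an adjacent pair like any other. Passing from \<open>n\<close> to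
  \<open>Suc n\<close> inserts the new digits at positions \<open>n\<close> and
  \<open>Suc n\<close>.\<close>

definition cyclic_word :: "nat \<Rightarrow> (nat \<Rightarrow> nat) \<Rightarrow> (nat \<Rightarrow> nat) \<Rightarrow> nat \<Rightarrow> nat" where
  "cyclic_word n z x j = (if j < n then z j else x (2 * n - 1 - j))"

text \<open>The last letter of \<open>block m (k m)\<close> is \<open>m - k m + 1\<close>, and it
  joins the digits \<open>m - k m\<close> and \<open>m - k m + 1\<close>; for \<open>k m = 0\<close>
  the pair is the strand of index \<open>m\<close>. At stage 0 truncated subtraction yields position
  0 for every \<open>k 0\<close>, the only pair of a word of length 2.\<close>

primrec compatible :: "(nat \<Rightarrow> nat) \<Rightarrow> nat \<Rightarrow> (nat \<Rightarrow> nat) \<Rightarrow> bool" where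
  "compatible k 0 W \<longleftrightarrow> True"
| "compatible k (Suc m) W \<longleftrightarrow>
     W (m - k m) = W (Suc (m - k m)) \<and> compatible k m (remove_pair (m - k m) W)"

lemma remove_insert_pair [simp]: "remove_pair s (insert_pair s c W) = W"
  by (intro ext) (auto simp: remove_pair_def insert_pair_def)

lemma compatible_cong:
  "(\<And>j. j < 2 * n \<Longrightarrow> W j = W' j) \<Longrightarrow> compatible k n W \<longleftrightarrow> compatible k n W'"
proof (induction n arbitrary: W W')
  case (Suc m)
  have "compatible k m (remove_pair (m - k m) W) \<longleftrightarrow> compatible k m (remove_pair (m - k m) W')"
    using Suc.prems by (intro Suc.IH) (simp add: remove_pair_def)
  moreover have "W (m - k m) = W' (m - k m)" "W (Suc (m - k m)) = W' (Suc (m - k m))"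
    using Suc.prems by simp_all
  ultimately show ?case
    by simp
qed simp

lemma nf_word_0 [simp]: "nf_word 0 k = []"
  by (simp add: nf_word_def)

lemma nf_word_1 [simp]: "nf_word (Suc 0) k = []"
  by (simp add: nf_word_def)

lemma nf_word_Suc: "m \<ge> 1 \<Longrightarrow> nf_word (Suc m) k = nf_word m k @ block m (k m)"
  by (simp add: nf_word_def)

text \<open>Each further letter moves the required pair one place to the left. Generator
  \<open>i\<close> sums over a digit \<open>d\<close> put at positions \<open>i - 1\<close> and
  \<open>i\<close>, while the previous stage demands equality at \<open>i\<close> and
  \<open>i + 1\<close>. This leaves the single term \<open>d = ?e\<close>, so no factor
  \<open>p\<close> arises and the value stays 0 or 1.\<close>

lemma word_act_block:
  fixes f :: "(nat \<Rightarrow> nat) \<Rightarrow> 'a::semiring_1"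
  assumes f: "\<And>z. (\<And>j. z j < p) \<Longrightarrow>
      f z = of_bool (compatible k m (cyclic_word m z x) \<and> (\<forall>j\<ge>m. x j = z j))"
    and x: "\<And>j. x j < p"
  shows "K \<le> m \<Longrightarrow> (\<And>j. z j < p) \<Longrightarrow> word_act p (block m K) f z =
    of_bool (cyclic_word (Suc m) z x (m - K) = cyclic_word (Suc m) z x (Suc (m - K)) \<and>
      compatible k m (remove_pair (m - K) (cyclic_word (Suc m) z x)) \<and> (\<forall>j\<ge>Suc m. x j = z j))"
proof (induction K arbitrary: z)
  case 0
  have "remove_pair m (cyclic_word (Suc m) z x) = cyclic_word m z x"
    by (intro ext) (auto simp: remove_pair_def cyclic_word_def)
  moreover have "cyclic_word (Suc m) z x m = z m" "cyclic_word (Suc m) z x (Suc m) = x m"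
    by (simp_all add: cyclic_word_def)
  moreover have "(\<forall>j\<ge>m. x j = z j) \<longleftrightarrow> z m = x m \<and> (\<forall>j\<ge>Suc m. x j = z j)"
    by (metis Suc_leD le_antisym not_less_eq_eq order_refl)
  ultimately show ?case
    using f[of z] 0 by auto
next
  case (Suc K)
  define i where "i = m - K"
  have i: "i \<ge> 1" "i \<le> m" "m - Suc K = i - 1"
    using Suc.prems by (auto simp: i_def)
  let ?J = "cyclic_word (Suc m) z x"
  let ?z = "\<lambda>d. z(i - 1 := d, i := d)"
  \<comment> \<open>The letter right of the two summed positions, untouched by the update:
    \<open>z (Suc i)\<close>, or \<open>x m\<close> when \<open>i = m\<close>.\<close>
  let ?e = "?J (Suc i)"
  have e: "?e < p"
    using x Suc.prems by (simp add: cyclic_word_def)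
  have "word_act p (block m K) f (?z d) =
      (if d = ?e then of_bool (compatible k m (remove_pair (i - 1) ?J) \<and> (\<forall>j\<ge>Suc m. x j = z j)) else 0)"
    if d: "d < p" for d
  proof -
    have *: "cyclic_word (Suc m) (?z d) x i = d" "cyclic_word (Suc m) (?z d) x (Suc i) = ?e"
      using i by (auto simp: cyclic_word_def)
    \<comment> \<open>In both words \<open>?e\<close> ends up at position \<open>i - 1\<close>: on
      the left as the updated digit, on the right as the old letter of position \<open>i + 1\<close>
      shifted down.\<close>
    have "remove_pair i (cyclic_word (Suc m) (?z d) x) = remove_pair (i - 1) ?J" if "d = ?e"
    proof
      fix j
      consider "j < i - 1" | "j = i - 1" | "j \<ge> i"
        by linarith
      then show "remove_pair i (cyclic_word (Suc m) (?z d) x) j = remove_pair (i - 1) ?J j"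
      proof cases
        case 1
        then have "j < i" "j < Suc m" "j \<noteq> i - 1"
          using i by auto
        with 1 show ?thesis
          by (simp add: remove_pair_def cyclic_word_def)
      next
        case 2
        then have "remove_pair (i - 1) ?J j = ?e"
          using i by (simp add: remove_pair_def)
        moreover have "remove_pair i (cyclic_word (Suc m) (?z d) x) j = d"
          using i unfolding 2 by (auto simp: remove_pair_def cyclic_word_def)
        ultimately show ?thesis
          using that by simp
      next
        case 3
        then have "\<not> j < i" "\<not> j < i - 1" "j + 2 \<noteq> i" "j + 2 \<noteq> i - 1"
          using i by auto
        then show ?thesis
          by (simp add: remove_pair_def cyclic_word_def)
      qed
    qed
    moreover have "?z d j = z j" if "j \<ge> Suc m" for j
    proof -
      have "j \<noteq> i - 1" "j \<noteq> i"
        using i that by auto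
      then show ?thesis by simp
    qed
    then have "(\<forall>j\<ge>Suc m. x j = ?z d j) \<longleftrightarrow> (\<forall>j\<ge>Suc m. x j = z j)"
      by metis
    moreover have "word_act p (block m K) f (?z d) =
        of_bool (cyclic_word (Suc m) (?z d) x i = cyclic_word (Suc m) (?z d) x (Suc i) \<and>
          compatible k m (remove_pair i (cyclic_word (Suc m) (?z d) x)) \<and> (\<forall>j\<ge>Suc m. x j = ?z d j))"
      unfolding i_def
    proof (rule Suc.IH)
      show "(z(m - K - 1 := d, m - K := d)) j < p" for j
        using Suc.prems(2) d by simp
    qed (use Suc.prems in simp)
    ultimately show ?thesis
      unfolding * by (cases "d = ?e") simp_all
  qed
  then have "word_act p (block m (Suc K)) f z =
      (if z (i - 1) = z i then \<Sum>d<p. (if d = ?e then of_bool (compatible k m (remove_pair (i - 1) ?J) \<and> (\<forall>j\<ge>Suc m. x j = z j)) else 0) else 0)"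
    by (simp add: word_act_append h_act_def i_def)
  also have "\<dots> = (if z (i - 1) = z i then of_bool (compatible k m (remove_pair (i - 1) ?J) \<and> (\<forall>j\<ge>Suc m. x j = z j)) else 0)"
    using e by simp
  also have "z (i - 1) = z i \<longleftrightarrow> ?J (m - Suc K) = ?J (Suc (m - Suc K))"
    using i by (auto simp: cyclic_word_def)
  finally show ?case
    unfolding i(3) by simp
qed

lemma word_act_nf_word:
  assumes "\<And>j. x j < p" "\<And>j. z j < p" "\<And>i. i \<in> {1..<n} \<Longrightarrow> k i \<le> i"
  shows "word_act p (nf_word n k) (\<lambda>z. of_bool (x = z)) z =
    (of_bool (compatible k n (cyclic_word n z x) \<and> (\<forall>j\<ge>n. x j = z j)) :: 'a::semiring_1)"
  using assms(2,3)
proof (induction n arbitrary: z)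
  case (Suc m)
  \<comment> \<open>\<open>nf_word\<close> has no block of index 0 while \<open>compatible\<close>
    has a stage 0; \<open>K = 0\<close> matches the empty block with the pair at position 0.\<close>
  define K where "K = (if m = 0 then 0 else k m)"
  have K: "K \<le> m" "m - K = m - k m"
    using Suc.prems(2)[of m] by (auto simp: K_def)
  have "word_act p (nf_word (Suc m) k) (\<lambda>z. of_bool (x = z)) z =
      (word_act p (block m K) (word_act p (nf_word m k) (\<lambda>z. of_bool (x = z))) z :: 'a)"
    by (cases "m = 0") (simp_all add: K_def nf_word_Suc word_act_append)
  also have "\<dots> = of_bool (compatible k (Suc m) (cyclic_word (Suc m) z x) \<and> (\<forall>j\<ge>Suc m. x j = z j))"
    using Suc assms(1) K by (subst word_act_block[where x = x and k = k]) auto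
  finally show ?case .
qed (auto simp: fun_eq_iff)

section \<open>Words that separate a normal form from its predecessors\<close>

definition lex_less :: "nat \<Rightarrow> (nat \<Rightarrow> nat) \<Rightarrow> (nat \<Rightarrow> nat) \<Rightarrow> bool" where
  "lex_less n k' k \<longleftrightarrow> (\<exists>i\<in>{1..<n}. k' i < k i \<and> (\<forall>j\<in>{i<..<n}. k' j = k j))"

lemma is_nf_Suc: "is_nf (Suc m) k \<Longrightarrow> is_nf m k"
  by (simp add: is_nf_def)

text \<open>Undoing the removals one stage at a time, the letters are chosen from \<open>{0, 1}\<close> so that at each
  stage \<open>m\<close> the removed pair is the \<^emph>\<open>rightmost\<close> pair of equal neighbours starting in \<open>{0..m}\<close>. A word
  compatible with another \<open>k'\<close> then has its pair further to the left at the first difference.\<close>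

lemma separating_word:
  assumes "is_nf n k"
  obtains W where "\<And>j. W j < 2" "compatible k n W"
    "\<And>k'. compatible k' n W \<Longrightarrow> (\<And>i. i \<in> {1..<n} \<Longrightarrow> k' i \<le> i) \<Longrightarrow> \<not> lex_less n k' k"
proof -
  \<comment> \<open>The third conjunct is the invariant: to the right of all nontrivial pairs
    inserted so far, neighbours differ. The normal form inequality places the next nontrivial pair
    in just this region, so no pair beyond it can be removed instead.\<close>
  have "\<exists>W. (\<forall>j. W j < 2) \<and> compatible k n W \<and>
      (\<forall>i. Suc i < n \<and> (\<forall>j\<in>{1..<n}. 0 < k j \<longrightarrow> j - k j < i) \<longrightarrow> W i \<noteq> W (Suc i)) \<and>
      (\<forall>k'. compatible k' n W \<and> (\<forall>i\<in>{1..<n}. k' i \<le> i) \<longrightarrow> \<not> lex_less n k' k)"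
    using assms
  proof (induction n)
    case 0
    then show ?case by (auto intro!: exI[of _ "\<lambda>_. 0"] simp: lex_less_def)
  next
    case (Suc m)
    then obtain W where W: "\<And>j. W j < 2" "compatible k m W"
      "\<And>i. Suc i < m \<Longrightarrow> (\<forall>j\<in>{1..<m}. 0 < k j \<longrightarrow> j - k j < i) \<Longrightarrow> W i \<noteq> W (Suc i)"
      "\<And>k'. compatible k' m W \<Longrightarrow> (\<forall>i\<in>{1..<m}. k' i \<le> i) \<Longrightarrow> \<not> lex_less m k' k"
      using is_nf_Suc by blast
    define s where "s = m - k m"
    \<comment> \<open>The new letter must differ from its right neighbour \<open>W s\<close> or,
      when the pair straddles the middle (\<open>s = m\<close>), from its left neighbour
      \<open>W (m - 1)\<close>, which preserves the invariant. Over letters 0 and 1,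
      \<open>1 - W t\<close> is the other letter.\<close>
    define t where "t = (if s = m then m - 1 else s)"
    define c where "c = 1 - W t"
    have c: "c < 2" "c \<noteq> W t"
      using W(1)[of t] unfolding c_def by presburger+
    define W' where "W' = insert_pair s c W"
    have sm: "s \<le> m"
      by (simp add: s_def)
    have nfm: "j - k j < s" if "1 \<le> j" "j < m" "0 < k j" "s < m" for j
      using Suc.prems that by (auto simp: is_nf_def s_def)
    have right: "W' i \<noteq> W' (Suc i)" if "s < i" "i \<le> m" for i
    proof (cases "i = Suc s")
      case True
      then show ?thesis using c that by (auto simp: W'_def insert_pair_def t_def)
    next
      case False
      then have i: "i \<ge> s + 2" using that by simp
      have "W (i - 2) \<noteq> W (Suc (i - 2))"
        using i that nfm by (intro W(3)) (auto, fastforce)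
      then show ?thesis
        using i by (simp add: W'_def insert_pair_def) (metis Suc_diff_le add_2_eq_Suc' add_leD2 diff_Suc_Suc numeral_2_eq_2)
    qed
    have "W' i \<noteq> W' (Suc i)" if i: "Suc i < Suc m" "\<forall>j\<in>{1..<Suc m}. 0 < k j \<longrightarrow> j - k j < i" for i
    proof (cases "s = m")
      case True
      show ?thesis
      proof (cases "Suc i = m")
        case True
        then show ?thesis using \<open>s = m\<close> c by (auto simp: W'_def insert_pair_def t_def)
      next
        case False
        then have "W i \<noteq> W (Suc i)" using i by (intro W(3)) auto
        then show ?thesis using \<open>s = m\<close> False i by (auto simp: W'_def insert_pair_def t_def)
      qed
    next
      case False
      then show ?thesis using i sm by (intro right) (auto simp: s_def)
    qed
    moreover have "\<not> lex_less (Suc m) k' k"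
      if k': "compatible k' (Suc m) W'" "\<forall>i\<in>{1..<Suc m}. k' i \<le> i" for k'
    proof
      assume "lex_less (Suc m) k' k"
      then obtain i where i: "1 \<le> i" "i < Suc m" "k' i < k i" "\<forall>j\<in>{i<..<Suc m}. k' j = k j"
        by (auto simp: lex_less_def)
      have km: "k m \<le> m" "k' m \<le> m"
        using Suc.prems k' i by (auto simp: is_nf_def)
      show False
      proof (cases "i = m")
        case True
        then have "s < m - k' m" using i km by (auto simp: s_def)
        then show False using right[of "m - k' m"] k' by simp
      next
        case False
        then have "k' m = k m" using i by auto
        then have "compatible k' m W" using k' by (simp add: W'_def flip: s_def)
        then have "\<not> lex_less m k' k" using k' by (intro W(4)) auto
        moreover have "lex_less m k' k"
          using i False by (auto simp: lex_less_def intro!: bexI[of _ i])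
        ultimately show False by blast
      qed
    qed
    moreover have "compatible k (Suc m) W'"
      using W(2) by (simp add: W'_def flip: s_def) (simp add: insert_pair_def)
    moreover have "\<forall>j. W' j < 2"
      using W(1) c by (simp add: W'_def insert_pair_def)
    ultimately show ?case by (intro exI[of _ W']) blast
  qed
  then show thesis using that by blast
qed


section \<open>Reduction to normal form\<close>

text \<open>The presentations of J_n and T_n differ only in the scalar belonging to
  \<open>red_idem\<close>, so one relation serves both. No rule lengthens a word, and commutations
  go in both directions.\<close>

inductive red :: "nat list \<Rightarrow> nat list \<Rightarrow> bool" where
  red_comm: "j + 2 \<le> i \<or> i + 2 \<le> j \<Longrightarrow> red [i, j] [j, i]"
| red_braid: "j = i + 1 \<or> i = j + 1 \<Longrightarrow> red [i, j, i] [i]"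
| red_idem: "red [i, i] [i]"
| red_refl: "red w w"
| red_trans: "red u v \<Longrightarrow> red v w \<Longrightarrow> red u w"
| red_append: "red u v \<Longrightarrow> red u' v' \<Longrightarrow> red (u @ u') (v @ v')"

lemma red_set: "red u v \<Longrightarrow> set v \<subseteq> set u"
  by (induction rule: red.induct) auto

lemma red_length: "red u v \<Longrightarrow> length v \<le> length u"
  by (induction rule: red.induct) auto

lemma red_context: "red u v \<Longrightarrow> red (a @ u @ b) (a @ v @ b)"
  by (intro red_append red_refl)

lemma red_jones_cong: "red u v \<Longrightarrow> u \<in> lists {1..<n} \<Longrightarrow> (u, v) \<in> jones_cong n"
proof (induction rule: red.induct)
  case (red_comm j i)
  then show ?case
    using jones_cong.far[of i n j] jones_cong.far[of j n i] by (auto intro: jones_cong.sym)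
next
  case (red_braid j i)
  then show ?case
    using jones_cong.up[of i n] jones_cong.down[of j n] by auto
next
  case (red_trans u v w)
  then show ?case
    using red_set[of u v] by (meson in_lists_conv_set jones_cong.trans subsetD)
qed (auto intro: jones_cong.intros)

lemma red_comm_word:
  assumes "\<And>j. j \<in> set v \<Longrightarrow> j + 2 \<le> i \<or> i + 2 \<le> j"
  shows "red (i # v) (v @ [i])" "red (v @ [i]) (i # v)"
proof -
  have "red (i # v) (v @ [i]) \<and> red (v @ [i]) (i # v)"
    using assms
  proof (induction v)
    case (Cons j v)
    then have j: "j + 2 \<le> i \<or> i + 2 \<le> j" and IH: "red (i # v) (v @ [i])" "red (v @ [i]) (i # v)"
      by auto
    have "red (i # j # v) (j # i # v)" "red (j # i # v) (i # j # v)"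
      using red_append[OF red_comm[OF j] red_refl[of v]] red_append[OF red_comm[of i j] red_refl[of v]] j
      by auto
    moreover have "red (j # i # v) (j # v @ [i])" "red (j # v @ [i]) (j # i # v)"
      using red_append[OF red_refl[of "[j]"]] IH by auto
    ultimately show ?case
      by (auto intro: red_trans)
  qed (simp add: red_refl)
  then show "red (i # v) (v @ [i])" "red (v @ [i]) (i # v)"
    by blast+
qed

definition red_minimal :: "nat list \<Rightarrow> bool" where
  "red_minimal u \<longleftrightarrow> (\<forall>v. red u v \<longrightarrow> length v = length u)"

lemma red_minimal_infix:
  assumes "red_minimal (a @ u @ b)"
  shows "red_minimal u"
  unfolding red_minimal_def
proof (intro allI impI)
  fix v assume "red u v"
  then have "length (a @ v @ b) = length (a @ u @ b)"
    using assms red_context unfolding red_minimal_def by blast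
  then show "length v = length u"
    by simp
qed

lemma red_minimal_red: "red_minimal u \<Longrightarrow> red u v \<Longrightarrow> red_minimal v"
  unfolding red_minimal_def by (metis red_trans)

lemma not_red_minimal: "red u v \<Longrightarrow> length v < length u \<Longrightarrow> \<not> red_minimal u"
  unfolding red_minimal_def by (metis nat_neq_iff)

text \<open>Between two consecutive occurrences of \<open>m\<close> there is at most one \<open>m - 1\<close>, by induction on \<open>m\<close>, and
  all other letters commute with \<open>m\<close>; the two occurrences could then be merged.\<close>

lemma red_minimal_top_once:
  assumes "red_minimal (a @ [m] @ b)" "set (a @ [m] @ b) \<subseteq> {1..m}"
  shows "m \<notin> set a" "m \<notin> set b"
proof -
  have "\<And>w. red_minimal w \<Longrightarrow> set w \<subseteq> {1..m} \<Longrightarrow> count_list w m \<le> 1"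
  proof (induction m)
    case (Suc m)
    show ?case
    proof (rule ccontr)
      let ?M = "Suc m"
      assume "\<not> count_list w ?M \<le> 1"
      then have cnt: "count_list w ?M \<ge> 2"
        by simp
      then have "?M \<in> set w"
        by (metis count_list_0_iff not_numeral_le_zero)
      then obtain x y where w: "w = x @ ?M # y" "?M \<notin> set x"
        by (meson split_list_first)
      then have "count_list y ?M \<ge> 1"
        using cnt by simp
      then have "?M \<in> set y"
        by (metis count_list_0_iff not_one_le_zero)
      then obtain v z where y: "y = v @ ?M # z" "?M \<notin> set v"
        by (meson split_list_first)
      have v: "set v \<subseteq> {1..m}"
        using Suc.prems(2) w y by (auto simp: le_Suc_eq)
      have minv: "red_minimal ([?M] @ v @ [?M])"
        using red_minimal_infix[of x "[?M] @ v @ [?M]" z] Suc.prems(1) w y by simp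
      then have "red_minimal v"
        by (rule red_minimal_infix)
      then have once: "count_list v m \<le> 1"
        using Suc.IH v by blast
      have "\<exists>v'. red ([?M] @ v @ [?M]) v' \<and> length v' < length ([?M] @ v @ [?M])"
      proof (cases "m \<in> set v")
        case False
        then have "\<And>j. j \<in> set v \<Longrightarrow> j + 2 \<le> ?M"
          using v by (metis Suc_le_mono add_2_eq_Suc' atLeastAtMost_iff le_antisym not_less_eq_eq subsetD)
        then have "red ([?M] @ v @ [?M]) ([?M] @ [?M] @ v)"
          by (intro red_append[OF red_refl[of "[?M]"]]) (simp add: red_comm_word(2))
        moreover have "red ([?M, ?M] @ v) ([?M] @ v)"
          by (intro red_append red_idem red_refl)
        ultimately have "red ([?M] @ v @ [?M]) ([?M] @ v)"
          by (auto intro: red_trans)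
        then show ?thesis
          by (intro exI[of _ "[?M] @ v"]) simp
      next
        case True
        then obtain v1 v2 where v12: "v = v1 @ m # v2"
          by (meson split_list)
        then have "count_list v1 m = 0" "count_list v2 m = 0"
          using once by auto
        then have far: "\<And>j. j \<in> set v1 \<union> set v2 \<Longrightarrow> j + 2 \<le> ?M"
          using v v12 unfolding count_list_0_iff
          by (metis Suc_le_mono UnE UnI1 add_2_eq_Suc' atLeastAtMost_iff in_set_conv_decomp le_antisym
              list.set_intros(2) not_less_eq_eq set_append subsetD UnCI)
        have "red (([?M] @ v1) @ [m] @ (v2 @ [?M])) ((v1 @ [?M]) @ [m] @ ([?M] @ v2))"
        proof (rule red_append[OF _ red_append[OF red_refl]])
          show "red ([?M] @ v1) (v1 @ [?M])" "red (v2 @ [?M]) ([?M] @ v2)"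
            using red_comm_word(1)[of v1 ?M] red_comm_word(2)[of v2 ?M] far by simp_all
        qed
        moreover have "red (v1 @ [?M, m, ?M] @ v2) (v1 @ [?M] @ v2)"
          by (intro red_context red_braid) simp
        ultimately have "red ([?M] @ v @ [?M]) (v1 @ [?M] @ v2)"
          using v12 by (auto intro: red_trans)
        then show ?thesis
          using v12 by (intro exI[of _ "v1 @ [?M] @ v2"]) simp
      qed
      then show False
        using not_red_minimal minv by blast
    qed
  qed simp
  then have "count_list (a @ [m] @ b) m \<le> 1"
    using assms by blast
  then have "count_list a m = 0" "count_list b m = 0"
    by auto
  then show "m \<notin> set a" "m \<notin> set b"
    unfolding count_list_0_iff .
qed

lemma block_Suc_left: "block (Suc m) (Suc k) = Suc m # block m k"
  by (induction k) auto

lemma block_append: "block i (a + b) = block i a @ block (i - a) b"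
  by (induction b) auto

lemma set_block: "k \<le> i \<Longrightarrow> set (block i k) \<subseteq> {i - k<..i}"
  by (induction k) (auto, fastforce+)

lemma set_nf_word: "(\<And>i. i \<in> {1..<n} \<Longrightarrow> k i \<le> i) \<Longrightarrow> set (nf_word n k) \<subseteq> {1..<n}"
  unfolding nf_word_def using set_block by fastforce

lemma nf_word_cong: "(\<And>i. i \<in> {1..<n} \<Longrightarrow> k i = k' i) \<Longrightarrow> nf_word n k = nf_word n k'"
  unfolding nf_word_def by (intro arg_cong[where f = concat] map_cong) auto

lemma nf_word_extend:
  assumes "m \<le> n" "\<And>i. m \<le> i \<Longrightarrow> i < n \<Longrightarrow> k i = 0"
  shows "nf_word n k = nf_word m k"
  using assms
proof (induction n)
  case (Suc n)
  show ?case
  proof (cases "m = Suc n")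
    case False
    then have "nf_word n k = nf_word m k"
      using Suc by auto
    then show ?thesis
      using Suc.prems False by (cases "n = 0") (auto simp: nf_word_Suc)
  qed simp
qed simp

text \<open>Otherwise the last letter \<open>s + 1\<close> of the first block reappears in the
  second one, directly after \<open>s + 2\<close>. It commutes with the letters from
  \<open>m\<close> down to \<open>s + 3\<close> in front of them, and then
  \<open>s + 1, s + 2, s + 1\<close> shortens the word.\<close>

lemma block_before_block:
  assumes min: "red_minimal (block j l @ block m K)" and "0 < l" "l \<le> j" "j < m" "K \<le> m"
  shows "j - l < m - K"
proof (rule ccontr)
  assume "\<not> j - l < m - K"
  define s where "s = j - l"
  obtain l' where l: "l = Suc l'"
    using \<open>0 < l\<close> by (cases l) auto
  \<comment> \<open>\<open>block m K\<close> consists of \<open>m - s - 2\<close> letters from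
    \<open>m\<close> down to \<open>s + 3\<close>, the two letters \<open>s + 2\<close> and
    \<open>s + 1\<close>, and \<open>r\<close> more.\<close>
  define r where "r = K - (m - s)"
  have K: "K = (m - s - 2) + Suc (Suc r)" and s: "s + 2 \<le> m" "Suc s = j - l'"
    using assms \<open>\<not> j - l < m - K\<close> by (auto simp: s_def r_def l)
  have "m - (m - s - 2) = Suc (Suc s)"
    using s by simp
  then have bK: "block m K = block m (m - s - 2) @ [s + 2, s + 1] @ block s r"
    unfolding K block_append by (simp add: block_Suc_left del: block.simps(2))
  have bl: "block j l = block j l' @ [s + 1]"
    using s by (simp add: l)
  let ?b = "block m (m - s - 2)"
  have "red ([s + 1] @ ?b) (?b @ [s + 1])"
    using red_comm_word(1)[of ?b "s + 1"] set_block[of "m - s - 2" m] s by fastforce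
  then have "red (block j l' @ ([s + 1] @ ?b) @ [s + 2, s + 1] @ block s r)
      (block j l' @ (?b @ [s + 1]) @ [s + 2, s + 1] @ block s r)"
    by (rule red_context)
  moreover have "red ((block j l' @ ?b) @ [s + 1, s + 2, s + 1] @ block s r)
      ((block j l' @ ?b) @ [s + 1] @ block s r)"
    by (intro red_context red_braid) simp
  ultimately have "red (block j l @ block m K) ((block j l' @ ?b) @ [s + 1] @ block s r)"
    by (auto simp: bl bK intro: red_trans)
  then show False
    using not_red_minimal[of "block j l @ block m K"] min by (fastforce simp: bl bK)
qed

text \<open>If the top letter \<open>?M\<close> occurs, it does so once, say in
  \<open>a ?M b\<close>. The normal form of \<open>b\<close> ends in \<open>block m K\<close>, and
  the rest of it has letters below \<open>m\<close>, which commute with \<open>?M\<close>; so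
  \<open>?M\<close> moves right and prolongs the block to \<open>block ?M (Suc K)\<close>. What
  remains in front uses only letters up to \<open>m\<close> and is normalized again. Minimality
  survives every step and finally yields the inequality for the new block.\<close>

lemma red_minimal_nf:
  assumes "red_minimal w" "set w \<subseteq> {1..m}"
  shows "\<exists>k. is_nf (Suc m) k \<and> red w (nf_word (Suc m) k)"
  using assms
proof (induction m arbitrary: w)
  case 0
  then show ?case
    by (auto simp: is_nf_def red_refl)
next
  case (Suc m)
  let ?M = "Suc m"
  show ?case
  proof (cases "?M \<in> set w")
    case False
    then have "set w \<subseteq> {1..m}"
      using Suc.prems(2) by (auto simp: le_Suc_eq)
    then obtain k where k: "is_nf ?M k" "red w (nf_word ?M k)"
      using Suc by blast
    have "nf_word (Suc ?M) (k(?M := 0)) = nf_word ?M k"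
      by (simp add: nf_word_Suc) (auto intro: nf_word_cong)
    moreover have "is_nf (Suc ?M) (k(?M := 0))"
      using k(1) by (auto simp: is_nf_def less_Suc_eq)
    ultimately show ?thesis
      using k(2) by metis
  next
    case True
    then obtain a b where w: "w = a @ [?M] @ b"
      by (metis append_Cons append_Nil split_list)
    have "?M \<notin> set a" "?M \<notin> set b"
      using red_minimal_top_once[of a ?M b] Suc.prems w by auto
    then have ab: "set a \<subseteq> {1..m}" "set b \<subseteq> {1..m}"
      using Suc.prems(2) w by (auto simp: le_Suc_eq)
    have "red_minimal b"
      using red_minimal_infix[of "a @ [?M]" b "[]"] Suc.prems(1) w by simp
    then obtain kb where kb: "is_nf ?M kb" "red b (nf_word ?M kb)"
      using Suc.IH ab by blast
    \<comment> \<open>For \<open>m = 0\<close> the value \<open>kb 0\<close> is arbitrary, so the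
      empty block is chosen explicitly.\<close>
    define K where "K = (if m = 0 then 0 else kb m)"
    have Km: "K \<le> m"
      using kb(1) by (auto simp: is_nf_def K_def)
    let ?u = "nf_word m kb"
    have nfb: "nf_word ?M kb = ?u @ block m K"
      by (cases "m = 0") (simp_all add: K_def nf_word_Suc)
    have setu: "set ?u \<subseteq> {1..<m}"
      using kb(1) by (intro set_nf_word) (auto simp: is_nf_def)
    have "red (a @ [?M] @ b) (a @ [?M] @ ?u @ block m K)"
      using red_append[OF red_refl[of "a @ [?M]"] kb(2)] nfb by simp
    moreover have "red (a @ ([?M] @ ?u) @ block m K) (a @ (?u @ [?M]) @ block m K)"
      using red_comm_word(1)[of ?u ?M] setu by (intro red_context) fastforce
    ultimately have "red w ((a @ ?u) @ block ?M (Suc K))"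
      using w by (auto simp: block_Suc_left simp del: block.simps(2) intro: red_trans)
    moreover from this have "red_minimal (a @ ?u)"
      using red_minimal_red[OF Suc.prems(1)] red_minimal_infix[of "[]" "a @ ?u"] by fastforce
    then obtain k where k: "is_nf ?M k" "red (a @ ?u) (nf_word ?M k)"
      using Suc.IH[of "a @ ?u"] ab setu by fastforce
    ultimately have red: "red w (nf_word ?M k @ block ?M (Suc K))"
      by (meson red_append red_refl red_trans)
    then have min: "red_minimal (nf_word ?M k @ block ?M (Suc K))"
      using red_minimal_red Suc.prems(1) by blast
    have lt: "j - k j < ?M - Suc K" if j: "1 \<le> j" "j < ?M" "0 < k j" for j
    proof -
      \<comment> \<open>Only the last nonempty block, of index \<open>l\<close>, touches the new
        one, so \<open>block_before_block\<close> is applied to it; an earlier block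
        \<open>j\<close> is compared through \<open>j - k j \<le> l - k l\<close>.\<close>
      define A where "A = {j. 1 \<le> j \<and> j < ?M \<and> 0 < k j}"
      have A: "finite A" "A \<noteq> {}"
        using j by (auto simp: A_def)
      define l where "l = Max A"
      have l: "1 \<le> l" "l < ?M" "0 < k l"
        using Max_in[OF A] by (auto simp: A_def l_def)
      have jl: "j \<le> l"
        using j A(1) by (auto simp: A_def l_def)
      have "k i = 0" if "Suc l \<le> i" "i < ?M" for i
        using Max_ge[OF A(1), of i] that l(1) unfolding l_def[symmetric] by (cases "k i = 0") (auto simp: A_def)
      then have "nf_word ?M k = nf_word (Suc l) k"
        using l by (intro nf_word_extend) auto
      then have "nf_word ?M k @ block ?M (Suc K) = nf_word l k @ (block l (k l) @ block ?M (Suc K)) @ []"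
        using l by (simp add: nf_word_Suc)
      then have "red_minimal (block l (k l) @ block ?M (Suc K))"
        using min red_minimal_infix by metis
      then have "l - k l < ?M - Suc K"
        using l k(1) Km by (intro block_before_block) (auto simp: is_nf_def)
      moreover have "j - k j \<le> l - k l"
        using k(1) j l jl by (cases "j = l") (auto simp: is_nf_def intro: less_imp_le)
      ultimately show ?thesis
        by simp
    qed
    let ?k = "k(?M := Suc K)"
    have "nf_word (Suc ?M) ?k = nf_word ?M k @ block ?M (Suc K)"
      by (simp add: nf_word_Suc) (auto intro: nf_word_cong)
    moreover have "is_nf (Suc ?M) ?k"
      using k(1) lt Km by (auto simp: is_nf_def less_Suc_eq)
    ultimately show ?thesis
      using red by metis
  qed
qed

lemma red_nf:
  assumes "w \<in> lists {1..<n}" "n \<ge> 1"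
  shows "\<exists>k. is_nf n k \<and> red w (nf_word n k)"
  using assms(1)
proof (induction w rule: length_induct)
  case (1 w)
  show ?case
  proof (cases "red_minimal w")
    case True
    moreover have "set w \<subseteq> {1..n - 1}"
      using 1 by fastforce
    ultimately show ?thesis
      using red_minimal_nf[of w "n - 1"] assms(2) by simp
  next
    case False
    then obtain v where v: "red w v" "length v < length w"
      unfolding red_minimal_def using red_length nat_less_le by blast
    then have "v \<in> lists {1..<n}"
      using 1 red_set by (metis in_lists_conv_set subsetD)
    then show ?thesis
      using 1 v by (meson red_trans)
  qed
qed


section \<open>Digits and the assigned matrices\<close>

text \<open>Digit 0 is the least significant one. The right Kronecker factor of
  \<open>H_mat n p i\<close>, of size \<open>p ^ (i - 1)\<close>, then carries the digits below
  \<open>i - 1\<close>, and the middle factor acts on the digits \<open>i - 1\<close> and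
  \<open>i\<close>.\<close>

definition digit :: "nat \<Rightarrow> nat \<Rightarrow> nat \<Rightarrow> nat" where
  "digit p a j = a div p ^ j mod p"

definition undigit :: "nat \<Rightarrow> nat \<Rightarrow> (nat \<Rightarrow> nat) \<Rightarrow> nat" where
  "undigit p n x = (\<Sum>j<n. x j * p ^ j)"

lemma digit_less: "0 < p \<Longrightarrow> digit p a j < p"
  by (simp add: digit_def)

lemma digit_eq_0:
  assumes "a < p ^ n" "n \<le> j"
  shows "digit p a j = 0"
proof (cases "p = 0")
  case True
  then show ?thesis
    using assms by (cases n; cases j) (auto simp: digit_def)
next
  case False
  then have "p ^ n \<le> p ^ j"
    using assms(2) by (simp add: power_increasing)
  then show ?thesis
    using assms(1) by (simp add: digit_def)
qed

lemma mod_power_eq_iff_digits: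
  "a mod p ^ k = b mod p ^ k \<longleftrightarrow> (\<forall>j<k. digit p a j = digit p b j)"
proof (cases "p = 0")
  case True
  then show ?thesis
    by (cases k) (auto simp: digit_def dest: spec[of _ 0])
next
  case False
  show ?thesis
  proof (induction k)
    case (Suc k)
    have eq: "x mod p ^ Suc k = p ^ k * digit p x k + x mod p ^ k" for x
      unfolding power_Suc2 mod_mult2_eq digit_def ..
    have "a mod p ^ Suc k = b mod p ^ Suc k \<longleftrightarrow>
        digit p a k = digit p b k \<and> a mod p ^ k = b mod p ^ k"
    proof
      assume *: "a mod p ^ Suc k = b mod p ^ Suc k"
      have "x mod p ^ k = x mod p ^ Suc k mod p ^ k" "digit p x k = x mod p ^ Suc k div p ^ k" for x
        using False unfolding eq by simp_all
      then show "digit p a k = digit p b k \<and> a mod p ^ k = b mod p ^ k"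
        using * by metis
    qed (simp add: eq del: power_Suc)
    then show ?case
      using Suc.IH by (auto simp: less_Suc_eq)
  qed simp
qed

lemma digits_eqI:
  assumes "p \<ge> 2" "\<And>j. digit p a j = digit p b j"
  shows "a = b"
proof -
  let ?k = "max a b"
  have "?k < p ^ ?k"
    using assms(1) by (intro power_gt_expt) auto
  then have "a < p ^ ?k" "b < p ^ ?k"
    by linarith+
  moreover have "a mod p ^ ?k = b mod p ^ ?k"
    unfolding mod_power_eq_iff_digits using assms(2) by blast
  ultimately show ?thesis
    by simp
qed

lemma digit_div_power: "digit p (a div p ^ k) j = digit p a (k + j)"
  by (simp add: digit_def power_add div_mult2_eq)

lemma div_power_eq_iff_digits:
  assumes "p \<ge> 2"
  shows "a div p ^ k = b div p ^ k \<longleftrightarrow> (\<forall>j\<ge>k. digit p a j = digit p b j)"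
proof
  assume "a div p ^ k = b div p ^ k"
  then have "digit p a (k + j) = digit p b (k + j)" for j
    by (simp flip: digit_div_power)
  then show "\<forall>j\<ge>k. digit p a j = digit p b j"
    by (metis le_add_diff_inverse)
next
  assume *: "\<forall>j\<ge>k. digit p a j = digit p b j"
  show "a div p ^ k = b div p ^ k"
    by (rule digits_eqI[OF assms]) (use * in \<open>simp add: digit_div_power\<close>)
qed

lemma undigit:
  assumes "\<And>j. j < n \<Longrightarrow> x j < p"
  shows "undigit p n x < p ^ n" "j < n \<Longrightarrow> digit p (undigit p n x) j = x j"
proof -
  have "undigit p n x < p ^ n \<and> (\<forall>j<n. digit p (undigit p n x) j = x j)"
    using assms
  proof (induction n)
    case (Suc n)
    let ?u = "undigit p n x"
    have u: "?u < p ^ n" "\<forall>j<n. digit p ?u j = x j"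
      using Suc by auto
    have eq: "undigit p (Suc n) x = ?u + x n * p ^ n"
      by (simp add: undigit_def)
    have "?u + x n * p ^ n < p ^ n + x n * p ^ n"
      using u by simp
    also have "\<dots> = Suc (x n) * p ^ n"
      by simp
    also have "\<dots> \<le> p * p ^ n"
      using Suc.prems[of n] by (intro mult_le_mono1) simp
    finally have "undigit p (Suc n) x < p ^ Suc n"
      by (simp add: eq)
    moreover have "digit p (undigit p (Suc n) x) j = x j" if "j < n" for j
    proof -
      have "undigit p (Suc n) x mod p ^ n = ?u mod p ^ n"
        by (simp add: eq)
      then show ?thesis
        using u that unfolding mod_power_eq_iff_digits by simp
    qed
    moreover have "digit p (undigit p (Suc n) x) n = x n"
      using Suc.prems[of n] u by (simp add: digit_def eq)
    ultimately show ?case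
      by (auto simp: less_Suc_eq)
  qed (simp add: undigit_def)
  then show "undigit p n x < p ^ n" "j < n \<Longrightarrow> digit p (undigit p n x) j = x j"
    by blast+
qed

lemma digit_undigit:
  assumes "\<And>j. j < n \<Longrightarrow> x j < p" "\<And>j. n \<le> j \<Longrightarrow> x j = 0"
  shows "digit p (undigit p n x) = x"
proof
  show "digit p (undigit p n x) j = x j" for j
    using undigit(1)[of n x p] undigit(2)[of n x p j] digit_eq_0[of "undigit p n x" p n j] assms by (cases "j < n") auto
qed

lemma H_mat_size:
  assumes "1 \<le> i" "i < n"
  shows "p ^ (n - i - 1) * p\<^sup>2 * p ^ (i - 1) = (p ^ n :: nat)"
proof -
  have "p ^ (n - i - 1) * p\<^sup>2 * p ^ (i - 1) = p ^ (n - i - 1 + 2 + (i - 1))"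
    by (simp only: power_add)
  also have "n - i - 1 + 2 + (i - 1) = n"
    using assms by simp
  finally show ?thesis .
qed

lemma H_mat_dim: "1 \<le> i \<Longrightarrow> i < n \<Longrightarrow> H_mat n p i \<in> carrier_mat (p ^ n) (p ^ n)"
proof (rule carrier_matI)
  assume i: "1 \<le> i" "i < n"
  show "dim_row (H_mat n p i) = p ^ n" "dim_col (H_mat n p i) = p ^ n"
    unfolding H_mat_size[OF i, symmetric] by (simp_all add: H_mat_def kron_def E_mat_def)
qed

lemma kron_index:
  assumes "r < dim_row A * dim_row B" "c < dim_col A * dim_col B"
  shows "(A \<otimes>\<^sub>k B) $$ (r, c) = A $$ (r div dim_row B, c div dim_col B) * B $$ (r mod dim_row B, c mod dim_col B)"
  using assms by (simp add: kron_def)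

lemma E_mat_square_index:
  assumes "r < p\<^sup>2" "c < p\<^sup>2"
  shows "(transpose_mat (E_mat p) * E_mat p :: 'a::semiring_1 mat) $$ (r, c) =
    of_bool (r div p = r mod p \<and> c div p = c mod p)"
  using assms by (simp add: E_mat_def scalar_prod_def)

text \<open>An index is cut into its quotient by \<open>p ^ Suc i\<close>, the two digits
  \<open>i\<close> and \<open>i - 1\<close>, and its remainder modulo \<open>p ^ (i - 1)\<close>.
  The identity factors compare the outer parts of \<open>a\<close> and \<open>b\<close>, while the
  middle factor imposes one condition on \<open>a\<close> and one on \<open>b\<close>.\<close>

lemma H_mat_index:
  assumes i: "1 \<le> i" "i < n" and p: "p \<ge> 2" and ab: "a < p ^ n" "b < p ^ n"
  shows "(H_mat n p i :: 'a::semiring_1 mat) $$ (a, b) =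
    of_bool (digit p a (i - 1) = digit p a i \<and> digit p b (i - 1) = digit p b i \<and>
      (\<forall>j. j \<noteq> i - 1 \<and> j \<noteq> i \<longrightarrow> digit p a j = digit p b j))"
proof -
  define q where "q = p ^ (i - 1)"
  define Q where "Q = p ^ (n - i - 1)"
  let ?E = "transpose_mat (E_mat p) * E_mat p :: 'a mat"
  have dE: "dim_row ?E = p\<^sup>2" "dim_col ?E = p\<^sup>2"
    by (simp_all add: E_mat_def)
  have q: "q > 0"
    using p by (simp add: q_def)
  have "p ^ n = Q * p\<^sup>2 * q"
    using H_mat_size[OF i] by (simp add: Q_def q_def)
  then have ab': "a < Q * p\<^sup>2 * q" "b < Q * p\<^sup>2 * q"
    using ab by simp_all
  then have r: "a div q < Q * p\<^sup>2" "b div q < Q * p\<^sup>2"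
    by (simp_all add: less_mult_imp_div_less)
  then have rr: "a div q div p\<^sup>2 < Q" "b div q div p\<^sup>2 < Q"
    by (simp_all add: less_mult_imp_div_less)
  have "p\<^sup>2 > 0"
    using p by simp
  then have m: "x mod p\<^sup>2 < p\<^sup>2" for x
    by simp
  have dk: "dim_row (1\<^sub>m Q \<otimes>\<^sub>k ?E) = Q * p\<^sup>2" "dim_col (1\<^sub>m Q \<otimes>\<^sub>k ?E) = Q * p\<^sup>2"
    by (simp_all add: kron_def dE del: index_mult_mat)
  have "(H_mat n p i :: 'a mat) $$ (a, b) =
      (1\<^sub>m Q \<otimes>\<^sub>k ?E) $$ (a div q, b div q) * 1\<^sub>m q $$ (a mod q, b mod q)"
    unfolding H_mat_def q_def[symmetric] Q_def[symmetric]
    by (subst kron_index) (use ab' dk in simp_all)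
  also have "(1\<^sub>m Q \<otimes>\<^sub>k ?E) $$ (a div q, b div q) =
      1\<^sub>m Q $$ (a div q div p\<^sup>2, b div q div p\<^sup>2) * ?E $$ (a div q mod p\<^sup>2, b div q mod p\<^sup>2)"
    by (subst kron_index) (use r dE in simp_all)
  also have "?E $$ (a div q mod p\<^sup>2, b div q mod p\<^sup>2) =
      of_bool (a div q mod p\<^sup>2 div p = a div q mod p\<^sup>2 mod p \<and> b div q mod p\<^sup>2 div p = b div q mod p\<^sup>2 mod p)"
    by (rule E_mat_square_index[OF m m])
  also have "(1\<^sub>m Q :: 'a mat) $$ (a div q div p\<^sup>2, b div q div p\<^sup>2) = of_bool (a div q div p\<^sup>2 = b div q div p\<^sup>2)"
    using rr by simp
  also have "(1\<^sub>m q :: 'a mat) $$ (a mod q, b mod q) = of_bool (a mod q = b mod q)"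
    using q by simp
  finally have H: "(H_mat n p i :: 'a mat) $$ (a, b) =
      of_bool (a div q div p\<^sup>2 = b div q div p\<^sup>2 \<and>
        (a div q mod p\<^sup>2 div p = a div q mod p\<^sup>2 mod p \<and> b div q mod p\<^sup>2 div p = b div q mod p\<^sup>2 mod p) \<and>
        a mod q = b mod q)"
    by (simp del: index_mult_mat)
  have dig: "x div q mod p\<^sup>2 div p = digit p x i" "x div q mod p\<^sup>2 mod p = digit p x (i - 1)"
    "x div q div p\<^sup>2 = x div p ^ Suc i" for x
  proof -
    have "x div q mod p\<^sup>2 = p * (x div q div p mod p) + x div q mod p"
      unfolding power2_eq_square mod_mult2_eq ..
    then show "x div q mod p\<^sup>2 div p = digit p x i" "x div q mod p\<^sup>2 mod p = digit p x (i - 1)"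
      using p i by (simp_all add: digit_def q_def flip: div_mult2_eq power_Suc2)
    have "q * p\<^sup>2 = p ^ (i - 1 + 2)"
      by (simp only: q_def power_add)
    also have "i - 1 + 2 = Suc i"
      using i by simp
    finally show "x div q div p\<^sup>2 = x div p ^ Suc i"
      by (simp only: div_mult2_eq[symmetric])
  qed
  have "(\<forall>j. j \<noteq> i - 1 \<and> j \<noteq> i \<longrightarrow> digit p a j = digit p b j) \<longleftrightarrow>
      (\<forall>j<i - 1. digit p a j = digit p b j) \<and> (\<forall>j\<ge>Suc i. digit p a j = digit p b j)"
  proof -
    have "j \<noteq> i - 1 \<and> j \<noteq> i \<longleftrightarrow> j < i - 1 \<or> j \<ge> Suc i" for j
      using i by auto
    then show ?thesis
      by metis
  qed
  then show ?thesis
    unfolding H dig div_power_eq_iff_digits[OF p] unfolding q_def mod_power_eq_iff_digits by auto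
qed

text \<open>If the digits \<open>i - 1\<close> and \<open>i\<close> of \<open>b\<close> agree, the
  nonzero rows of column \<open>b\<close> arise by replacing both by a common digit
  \<open>d\<close>, and reading off digit \<open>i\<close> inverts this. Otherwise the column is
  zero.\<close>

lemma sum_H_mat:
  assumes i: "1 \<le> i" "i < n" and p: "p \<ge> 2" and b: "b < p ^ n"
  shows "(\<Sum>c<p ^ n. f (digit p c) * H_mat n p i $$ (c, b)) = h_act p i f (digit p b)"
proof (cases "digit p b (i - 1) = digit p b i")
  case True
  define C where "C c \<longleftrightarrow> digit p c (i - 1) = digit p c i \<and>
      (\<forall>j. j \<noteq> i - 1 \<and> j \<noteq> i \<longrightarrow> digit p c j = digit p b j)" for c
  define z where "z d = (digit p b)(i - 1 := d, i := d)" for d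
  have zC: "digit p c = z (digit p c i)" if "C c" for c
    using that by (auto simp: C_def z_def fun_eq_iff)
  have du: "undigit p n (z d) < p ^ n" "digit p (undigit p n (z d)) = z d" if "d < p" for d
  proof -
    have "z d j < p" for j
      using that digit_less[of p b j] by (auto simp: z_def)
    moreover have "z d j = 0" if "n \<le> j" for j
      using that i b by (auto simp: z_def digit_eq_0)
    ultimately show "undigit p n (z d) < p ^ n" "digit p (undigit p n (z d)) = z d"
      by (auto intro!: undigit digit_undigit)
  qed
  have "(\<Sum>c<p ^ n. f (digit p c) * H_mat n p i $$ (c, b)) =
      (\<Sum>c<p ^ n. if C c then f (digit p c) else 0)"
    using i p b True by (intro sum.cong HOL.refl) (auto simp: H_mat_index C_def)
  also have "\<dots> = (\<Sum>c\<in>{c\<in>{..<p ^ n}. C c}. f (digit p c))"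
    by (intro sum.inter_filter[symmetric]) simp
  also have "\<dots> = (\<Sum>d<p. f (z d))"
  proof (rule sum.reindex_bij_witness[of _ "\<lambda>d. undigit p n (z d)" "\<lambda>c. digit p c i"])
    show "undigit p n (z (digit p c i)) = c" if "c \<in> {c \<in> {..<p ^ n}. C c}" for c
    proof (rule digits_eqI[OF p])
      show "digit p (undigit p n (z (digit p c i))) j = digit p c j" for j
        using p zC[of c] du(2)[OF digit_less[of p c i]] that by simp
    qed
    show "undigit p n (z d) \<in> {c \<in> {..<p ^ n}. C c}" "digit p (undigit p n (z d)) i = d"
      if "d \<in> {..<p}" for d
      using that du[of d] by (auto simp: C_def z_def)
    show "f (z (digit p c i)) = f (digit p c)" if "c \<in> {c \<in> {..<p ^ n}. C c}" for c
      using zC[of c] that by simp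
  qed (use p in \<open>auto simp: digit_less\<close>)
  finally show ?thesis
    using True by (simp add: h_act_def z_def)
next
  case False
  then show ?thesis
    using i p b by (simp add: h_act_def H_mat_index)
qed

section \<open>Products of the assigned matrices along words\<close>

definition word_mat :: "nat \<Rightarrow> nat \<Rightarrow> nat list \<Rightarrow> 'a::semiring_1 mat" where
  "word_mat n p w = foldr (\<lambda>i A. H_mat n p i * A) w (1\<^sub>m (p ^ n))"

lemma word_mat_Nil [simp]: "word_mat n p [] = 1\<^sub>m (p ^ n)"
  by (simp add: word_mat_def)

lemma word_mat_Cons [simp]: "word_mat n p (i # w) = H_mat n p i * word_mat n p w"
  by (simp add: word_mat_def)

lemma word_mat_carrier: "w \<in> lists {1..<n} \<Longrightarrow> word_mat n p w \<in> carrier_mat (p ^ n) (p ^ n)"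
  by (induction w) (auto intro!: mult_carrier_mat H_mat_dim)

lemma word_mat_append:
  assumes "u \<in> lists {1..<n}" "v \<in> lists {1..<n}"
  shows "word_mat n p (u @ v) = (word_mat n p u * word_mat n p v :: 'a::semiring_1 mat)"
  using assms(1)
proof (induction u)
  case Nil
  then show ?case
    by (simp add: left_mult_one_mat[OF word_mat_carrier[OF assms(2)]])
next
  case (Cons i u)
  then have "(H_mat n p i :: 'a mat) \<in> carrier_mat (p ^ n) (p ^ n)"
    "(word_mat n p u :: 'a mat) \<in> carrier_mat (p ^ n) (p ^ n)"
    by (auto intro!: H_mat_dim word_mat_carrier)
  then show ?case
    using Cons by (simp add: assoc_mult_mat[OF _ _ word_mat_carrier[OF assms(2)]])
qed

lemma mult_mat_index:
  assumes "A \<in> carrier_mat N N" "B \<in> carrier_mat N N" "a < N" "b < N"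
  shows "(A * B) $$ (a, b) = (\<Sum>c<N. A $$ (a, c) * B $$ (c, b))"
  using assms by (simp add: scalar_prod_def atLeast0LessThan)

lemma mult_mat_index_nonzero:
  fixes A B :: "nat mat"
  assumes "A \<in> carrier_mat N N" "B \<in> carrier_mat N N" "a < N" "b < N"
  shows "(A * B) $$ (a, b) \<noteq> 0 \<longleftrightarrow> (\<exists>c<N. A $$ (a, c) \<noteq> 0 \<and> B $$ (c, b) \<noteq> 0)"
  unfolding mult_mat_index[OF assms] by (simp add: Bex_def)

text \<open>The starting function is the unit row vector of index \<open>a\<close>. Induction peels
  off the last letter because \<open>word_act\<close> applies it last.\<close>

lemma word_mat_index:
  assumes "w \<in> lists {1..<n}" "p \<ge> 2" "a < p ^ n" "b < p ^ n"
  shows "(word_mat n p w :: 'a::semiring_1 mat) $$ (a, b) =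
    word_act p w (\<lambda>z. of_bool (digit p a = z)) (digit p b)"
  using assms(1,4)
proof (induction w arbitrary: b rule: rev_induct)
  case Nil
  moreover have "digit p a = digit p b \<longleftrightarrow> a = b"
    using digits_eqI[OF assms(2)] by metis
  ultimately show ?case
    using assms by simp
next
  case (snoc i w)
  then have i: "1 \<le> i" "i < n"
    by auto
  have "word_mat n p (w @ [i]) = (word_mat n p w * H_mat n p i :: 'a mat)"
    using snoc.prems by (subst word_mat_append) (auto simp: right_mult_one_mat[OF H_mat_dim[OF i]])
  moreover have "(word_mat n p w :: 'a mat) \<in> carrier_mat (p ^ n) (p ^ n)"
    using snoc.prems by (intro word_mat_carrier) auto
  ultimately have "(word_mat n p (w @ [i]) :: 'a mat) $$ (a, b) =
      (\<Sum>c<p ^ n. word_mat n p w $$ (a, c) * H_mat n p i $$ (c, b))"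
    using mult_mat_index[OF _ H_mat_dim[OF i] assms(3) snoc.prems(2)] by simp
  also have "\<dots> = (\<Sum>c<p ^ n. word_act p w (\<lambda>z. of_bool (digit p a = z)) (digit p c) * H_mat n p i $$ (c, b))"
    using snoc by (intro sum.cong) auto
  finally show ?case
    using sum_H_mat[OF i assms(2) snoc.prems(2)] by (simp add: word_act_append)
qed

text \<open>Matrix indices only produce digit sequences bounded by \<open>p\<close>, which is the
  condition under which the braid identities for \<open>h_act\<close> hold.\<close>

lemma word_mat_eqI:
  assumes "u \<in> lists {1..<n}" "v \<in> lists {1..<n}" "p \<ge> 2"
    and "\<And>f z. (\<And>j. z j < p) \<Longrightarrow> word_act p u f z = (word_act p v f z :: 'a::semiring_1)"
  shows "word_mat n p u = (word_mat n p v :: 'a mat)"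
  using word_mat_carrier[OF assms(1), where p = p, where 'a = 'a]
    word_mat_carrier[OF assms(2), where p = p, where 'a = 'a] assms
  by (intro eq_matI) (auto simp: word_mat_index digit_less)

section \<open>The defining relations for the assigned matrices\<close>

lemma word_mat_comm:
  assumes "i \<in> {1..<n}" "j \<in> {1..<n}" "j + 2 \<le> i \<or> i + 2 \<le> j" "p \<ge> 2"
  shows "word_mat n p [i, j] = (word_mat n p [j, i] :: 'a::semiring_1 mat)"
proof (rule word_mat_eqI)
  fix f :: "(nat \<Rightarrow> nat) \<Rightarrow> 'a" and z
  have "h_act p i (h_act p j f) = h_act p j (h_act p i f)"
    using assms h_act_far[of i j p f] h_act_far[of j i p f] by auto
  then show "word_act p [i, j] f z = word_act p [j, i] f z"
    by simp
qed (use assms in auto)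

lemma word_mat_braid:
  assumes "i \<in> {1..<n}" "j \<in> {1..<n}" "j = i + 1 \<or> i = j + 1" "p \<ge> 2"
  shows "word_mat n p [i, j, i] = word_mat n p [i]"
  using assms by (intro word_mat_eqI) (auto simp: h_act_braid_up h_act_braid_down)

lemma word_mat_idem:
  assumes "i \<in> {1..<n}" "p \<ge> 2"
  shows "word_mat n p [i, i] = of_nat p \<cdot>\<^sub>m (word_mat n p [i] :: 'a::semiring_1 mat)"
proof (rule eq_matI)
  have w: "[i] \<in> lists {1..<n}" "[i, i] \<in> lists {1..<n}"
    using assms by auto
  note dims = carrier_matD[OF word_mat_carrier[OF w(1)]] carrier_matD[OF word_mat_carrier[OF w(2)]]
  show "dim_row (word_mat n p [i, i]) = dim_row (of_nat p \<cdot>\<^sub>m word_mat n p [i])"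
    "dim_col (word_mat n p [i, i]) = dim_col (of_nat p \<cdot>\<^sub>m word_mat n p [i])"
    by (simp_all only: index_smult_mat dims)
  fix a b
  assume "a < dim_row (of_nat p \<cdot>\<^sub>m (word_mat n p [i] :: 'a mat))" "b < dim_col (of_nat p \<cdot>\<^sub>m (word_mat n p [i] :: 'a mat))"
  then have ab: "a < p ^ n" "b < p ^ n"
    by (simp_all only: index_smult_mat dims)
  then have "(of_nat p \<cdot>\<^sub>m (word_mat n p [i] :: 'a mat)) $$ (a, b) = of_nat p * word_mat n p [i] $$ (a, b)"
    by (intro index_smult_mat) (simp_all only: dims)
  then show "(word_mat n p [i, i] :: 'a mat) $$ (a, b) = (of_nat p \<cdot>\<^sub>m word_mat n p [i]) $$ (a, b)"
    unfolding word_mat_index[OF w(1) assms(2) ab] word_mat_index[OF w(2) assms(2) ab]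
    using assms by (simp add: h_act_idem)
qed

text \<open>Over the naturals nothing cancels: an entry of a product is nonzero iff some
  intermediate index links two nonzero entries, which is composition of relations. Entries may be
  proper powers of \<open>p\<close>, so nonvanishing replaces the value 1.\<close>

lemma word_rel_iff:
  assumes "w \<in> lists {1..<n}" "p \<ge> 2"
  shows "(a, b) \<in> word_rel n p w \<longleftrightarrow> a < p ^ n \<and> b < p ^ n \<and> (word_mat n p w :: nat mat) $$ (a, b) \<noteq> 0"
  using assms(1)
proof (induction w arbitrary: a)
  case Nil
  then show ?case
    by (auto simp: word_rel_def mat_rel_def split: if_splits)
next
  case (Cons i w)
  then have i: "1 \<le> i" "i < n" and w: "w \<in> lists {1..<n}"
    by auto
  note H = H_mat_dim[OF i, where p = p, where 'a = nat]
  have "(a, b) \<in> word_rel n p (i # w) \<longleftrightarrow>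
      (\<exists>c. a < p ^ n \<and> c < p ^ n \<and> (H_mat n p i :: nat mat) $$ (a, c) = 1 \<and> (c, b) \<in> word_rel n p w)"
    using H by (auto simp: word_rel_def mat_rel_def)
  also have "\<dots> \<longleftrightarrow> a < p ^ n \<and> b < p ^ n \<and>
      (\<exists>c<p ^ n. (H_mat n p i :: nat mat) $$ (a, c) \<noteq> 0 \<and> (word_mat n p w :: nat mat) $$ (c, b) \<noteq> 0)"
    using Cons i assms(2) by (auto simp: H_mat_index)
  also have "\<dots> \<longleftrightarrow> a < p ^ n \<and> b < p ^ n \<and> (word_mat n p (i # w) :: nat mat) $$ (a, b) \<noteq> 0"
    using mult_mat_index_nonzero[OF H word_mat_carrier[OF w]] by auto
  finally show ?case .
qed

section \<open>Relations and matrices assigned to the elements of J_n\<close>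

lemma jones_cong_lists:
  "(u, v) \<in> jones_cong n \<Longrightarrow> u \<in> lists {1..<n} \<and> v \<in> lists {1..<n}"
  by (induction rule: jones_cong.induct) auto

text \<open>The matrices satisfy the idempotent law only up to the factor \<open>p\<close>, which
  does not affect nonvanishing.\<close>

lemma jones_cong_word_rel:
  assumes "p \<ge> 2"
  shows "(u, v) \<in> jones_cong n \<Longrightarrow> word_rel n p u = word_rel n p v"
proof (induction rule: jones_cong.induct)
  case (far i j)
  then show ?case
    using assms word_mat_comm[of i n j p, where 'a = nat] by (auto simp: word_rel_iff)
next
  case (up i)
  then show ?case
    using assms word_mat_braid[of i n "i + 1" p, where 'a = nat] by (auto simp: word_rel_iff simp del: word_mat_Cons)
next
  case (down i)
  then show ?case
    using assms word_mat_braid[of "i + 1" n i p, where 'a = nat] by (auto simp: word_rel_iff simp del: word_mat_Cons)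
next
  case (idem i)
  have "[i] \<in> lists {1..<n}"
    using idem by simp
  note c = carrier_matD[OF word_mat_carrier[OF this, where p = p, where 'a = nat]]
  have "(word_mat n p [i, i] :: nat mat) $$ (a, b) = p * word_mat n p [i] $$ (a, b)"
    if "a < p ^ n" "b < p ^ n" for a b
    using idem assms word_mat_idem[of i n p, where 'a = nat] that c by (simp del: word_mat_Cons)
  then show ?case
    using idem assms by (auto simp: word_rel_iff simp del: word_mat_Cons)
next
  case (mult u v u' v')
  have app: "(a, b) \<in> word_rel n p (x @ y) \<longleftrightarrow> (\<exists>c. (a, c) \<in> word_rel n p x \<and> (c, b) \<in> word_rel n p y)"
    if "x \<in> lists {1..<n}" "y \<in> lists {1..<n}" for a b x y
    using that assms mult_mat_index_nonzero[OF word_mat_carrier[OF that(1)] word_mat_carrier[OF that(2)]]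
    by (auto simp: word_rel_iff word_mat_append)
  have "(a, b) \<in> word_rel n p (u @ u') \<longleftrightarrow> (a, b) \<in> word_rel n p (v @ v')" for a b
    using jones_cong_lists[OF mult.hyps(1)] jones_cong_lists[OF mult.hyps(2)] by (simp add: app mult.IH)
  then show ?case
    by (simp add: set_eq_iff)
qed auto

lemma jones_rel_class:
  assumes "w \<in> lists {1..<n}" "p \<ge> 2"
  shows "jones_rel n p (jones_class n w) = word_rel n p w"
proof -
  have "w \<in> jones_class n w"
    using jones_cong.refl[OF assms(1)] by (simp add: jones_class_def)
  moreover have "word_rel n p v = word_rel n p w" if "v \<in> jones_class n w" for v
    using that jones_cong_word_rel[OF assms(2), of w v n] by (simp add: jones_class_def)
  ultimately show ?thesis
    unfolding jones_rel_def by (subst the_elem_image_unique[where f = "word_rel n p" and a = "word_rel n p w"]) blast+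
qed

lemma is_nf_le: "is_nf n k \<Longrightarrow> i \<in> {1..<n} \<Longrightarrow> k i \<le> i"
  by (simp add: is_nf_def)

lemma nf_word_lists: "is_nf n k \<Longrightarrow> nf_word n k \<in> lists {1..<n}"
  using set_nf_word[of n k] is_nf_le by blast

text \<open>No scalars occur here: the same pattern gives the matrix product over any semiring and,
  through the naturals, the 0-1 matrix of the relation. The column \<open>b\<close> supplies the
  first half of the cyclic word.\<close>

definition nf_entry :: "nat \<Rightarrow> nat \<Rightarrow> (nat \<Rightarrow> nat) \<Rightarrow> nat \<Rightarrow> nat \<Rightarrow> bool" where
  "nf_entry n p k a b \<longleftrightarrow> compatible k n (cyclic_word n (digit p b) (digit p a))"

lemma word_mat_nf_word:
  assumes "is_nf n k" "p \<ge> 2" "a < p ^ n" "b < p ^ n"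
  shows "word_mat n p (nf_word n k) $$ (a, b) = (of_bool (nf_entry n p k a b) :: 'a::semiring_1)"
proof -
  have "\<forall>j\<ge>n. digit p a j = digit p b j"
    using assms by (simp add: digit_eq_0)
  then show ?thesis
    unfolding word_mat_index[OF nf_word_lists[OF assms(1)] assms(2-4)]
    using assms(2) by (subst word_act_nf_word[OF _ _ is_nf_le[OF assms(1)]]) (auto simp: digit_less nf_entry_def)
qed

lemma jones_mat_nf_word:
  assumes "is_nf n k" "p \<ge> 2" "a < p ^ n" "b < p ^ n"
  shows "jones_mat n p (jones_class n (nf_word n k)) $$ (a, b) = (of_bool (nf_entry n p k a b) :: 'a::semiring_1)"
  unfolding jones_mat_def jones_rel_class[OF nf_word_lists[OF assms(1)] assms(2)]
  using assms word_mat_nf_word[OF assms, where 'a = nat]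
  by (simp add: rel_mat_def word_rel_iff[OF nf_word_lists[OF assms(1)] assms(2)])

lemma separating_entry:
  assumes "is_nf n k" "p \<ge> 2"
  obtains a b where "a < p ^ n" "b < p ^ n" "nf_entry n p k a b"
    "\<And>k'. is_nf n k' \<Longrightarrow> lex_less n k' k \<Longrightarrow> \<not> nf_entry n p k' a b"
proof -
  obtain W where W: "\<And>j. W j < 2" "compatible k n W"
    "\<And>k'. compatible k' n W \<Longrightarrow> (\<And>i. i \<in> {1..<n} \<Longrightarrow> k' i \<le> i) \<Longrightarrow> \<not> lex_less n k' k"
    using separating_word[OF assms(1)] by blast
  have Wp: "W j < p" for j
    using W(1)[of j] assms(2) by simp
  \<comment> \<open>Cutting \<open>W\<close> in the middle and reading the second half backwards
    inverts \<open>cyclic_word\<close>; the letters 0 and 1 are digits since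
    \<open>p \<ge> 2\<close>.\<close>
  define a where "a = undigit p n (\<lambda>j. W (2 * n - 1 - j))"
  define b where "b = undigit p n W"
  have ab: "a < p ^ n" "b < p ^ n"
    using Wp by (auto simp: a_def b_def intro!: undigit)
  have "nf_entry n p k' a b \<longleftrightarrow> compatible k' n W" for k'
    unfolding nf_entry_def
  proof (rule compatible_cong)
    fix j assume "j < 2 * n"
    then show "cyclic_word n (digit p b) (digit p a) j = W j"
      using Wp by (auto simp: cyclic_word_def a_def b_def undigit)
  qed
  then show thesis
    using that[OF ab] W is_nf_le by metis
qed

section \<open>Lexicographical order and independence of normal forms\<close>

lemma lex_less_linear:
  assumes "i \<in> {1..<n}" "k i \<noteq> k' i"
  shows "lex_less n k k' \<or> lex_less n k' k"
proof -
  define A where "A = {i\<in>{1..<n}. k i \<noteq> k' i}"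
  have A: "finite A" "A \<noteq> {}"
    using assms by (auto simp: A_def)
  have "Max A \<in> A"
    using A by (rule Max_in)
  moreover have "k j = k' j" if "j \<in> {Max A<..<n}" for j
  proof (rule ccontr)
    assume "k j \<noteq> k' j"
    then have "j \<in> A"
      using that \<open>Max A \<in> A\<close> by (simp add: A_def)
    then show False
      using Max_ge[OF A(1)] that by fastforce
  qed
  ultimately have "Max A \<in> {1..<n}" "k (Max A) \<noteq> k' (Max A)"
    "\<forall>j\<in>{Max A<..<n}. k j = k' j" "\<forall>j\<in>{Max A<..<n}. k' j = k j"
    by (auto simp only: A_def mem_Collect_eq)
  then show ?thesis
    unfolding lex_less_def using nat_neq_iff by blast
qed

lemma lex_less_trans: "lex_less n k l \<Longrightarrow> lex_less n l m \<Longrightarrow> lex_less n k m"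
proof -
  assume "lex_less n k l" "lex_less n l m"
  then obtain i j where i: "i \<in> {1..<n}" "k i < l i" "\<forall>j\<in>{i<..<n}. k j = l j"
    and j: "j \<in> {1..<n}" "l j < m j" "\<forall>i\<in>{j<..<n}. l i = m i"
    by (auto simp: lex_less_def)
  have "k (max i j) < m (max i j)"
    using i j by (cases i j rule: linorder_cases) auto
  then show ?thesis
    unfolding lex_less_def using i j by (intro bexI[of _ "max i j"]) auto
qed

lemma lex_less_asym: "lex_less n k l \<Longrightarrow> \<not> lex_less n l k"
  using lex_less_trans[of n k l k] by (auto simp: lex_less_def)

text \<open>Congruent words have the same relation, so their patterns for \<open>p = 2\<close>
  coincide; if the exponents differed, the separating entry of the lexicographically larger normal
  form would tell them apart.\<close>

lemma nf_unique:
  assumes "is_nf n k" "is_nf n k'" "jones_class n (nf_word n k) = jones_class n (nf_word n k')"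
    and "i \<in> {1..<n}"
  shows "k i = k' i"
proof (rule ccontr)
  have eq: "nf_entry n 2 k a b \<longleftrightarrow> nf_entry n 2 k' a b" if "a < 2 ^ n" "b < 2 ^ n" for a b
    using jones_mat_nf_word[OF assms(1) _ that, where 'a = nat] jones_mat_nf_word[OF assms(2) _ that, where 'a = nat]
      assms(3) by (simp add: of_bool_eq_iff)
  assume "k i \<noteq> k' i"
  then have "lex_less n k k' \<or> lex_less n k' k"
    using assms(4) lex_less_linear by blast
  moreover have "\<not> lex_less n l l'"
    if l: "is_nf n l" "is_nf n l'" and eq: "\<And>a b. a < 2 ^ n \<Longrightarrow> b < 2 ^ n \<Longrightarrow> nf_entry n 2 l a b \<longleftrightarrow> nf_entry n 2 l' a b" for l l'
  proof
    assume "lex_less n l l'"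
    then obtain a b where "a < 2 ^ n" "b < 2 ^ n" "nf_entry n 2 l' a b" "\<not> nf_entry n 2 l a b"
      using separating_entry[OF l(2), of 2] l(1) by (metis le_refl)
    then show False
      using eq by blast
  qed
  ultimately show False
    using assms(1,2) eq by blast
qed

text \<open>Among the normal forms with nonzero coefficient take the lexicographically largest: at
  its separating entry it is the only one to contribute. The assumption \<open>inj\<close> rules out
  two functions describing the same normal form.\<close>

lemma nf_independent:
  fixes c :: "(nat \<Rightarrow> nat) \<Rightarrow> 'a::field"
  assumes "finite S" "\<And>k. k \<in> S \<Longrightarrow> is_nf n k" "p \<ge> 2"
    and inj: "\<And>k k'. k \<in> S \<Longrightarrow> k' \<in> S \<Longrightarrow> k \<noteq> k' \<Longrightarrow> \<exists>i\<in>{1..<n}. k i \<noteq> k' i"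
    and zero: "\<And>a b. a < p ^ n \<Longrightarrow> b < p ^ n \<Longrightarrow> (\<Sum>k\<in>S. c k * of_bool (nf_entry n p k a b)) = 0"
    and "k \<in> S"
  shows "c k = 0"
proof (rule ccontr)
  assume "c k \<noteq> 0"
  let ?T = "{k\<in>S. c k \<noteq> 0}"
  have "\<exists>m\<in>?T. \<forall>l\<in>?T. l \<noteq> m \<longrightarrow> \<not> lex_less n m l"
    using assms(1,6) \<open>c k \<noteq> 0\<close>
    by (intro Finite_Set.bex_max_element) (auto intro!: asymp_onI transp_onI intro: lex_less_trans dest: lex_less_asym)
  then obtain m where m: "m \<in> S" "c m \<noteq> 0" "\<And>l. l \<in> S \<Longrightarrow> c l \<noteq> 0 \<Longrightarrow> l \<noteq> m \<Longrightarrow> \<not> lex_less n m l"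
    by blast
  obtain a b where ab: "a < p ^ n" "b < p ^ n" "nf_entry n p m a b"
    "\<And>k'. is_nf n k' \<Longrightarrow> lex_less n k' m \<Longrightarrow> \<not> nf_entry n p k' a b"
    using separating_entry[OF assms(2)[OF m(1)] assms(3)] by blast
  have "c l * of_bool (nf_entry n p l a b) = 0" if l: "l \<in> S - {m}" for l
  proof (cases "c l = 0")
    case False
    then have "lex_less n l m"
      using inj[of l m] lex_less_linear[of _ n l m] m(1,3) l by blast
    then show ?thesis
      using ab(4) assms(2) l by auto
  qed simp
  then have "(\<Sum>k\<in>S - {m}. c k * of_bool (nf_entry n p k a b)) = 0"
    by (rule sum.neutral[OF ballI])
  then have "(\<Sum>k\<in>S. c k * of_bool (nf_entry n p k a b)) = c m * of_bool (nf_entry n p m a b)"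
    unfolding sum.remove[OF assms(1) m(1)] by (simp only: add_0_right)
  then show False
    using zero[OF ab(1,2)] ab(3) m(2) by simp
qed


section \<open>The free algebra and its matrix representation\<close>

lemma free_alg_carrier_iff:
  "f \<in> carrier (free_alg n) \<longleftrightarrow> finite {w. f w \<noteq> 0} \<and> {w. f w \<noteq> 0} \<subseteq> lists {1..<n}"
  by (simp add: free_alg_def)

lemma free_alg_simps:
  "\<zero>\<^bsub>free_alg n\<^esub> = (\<lambda>w. 0)" "\<one>\<^bsub>free_alg n\<^esub> = word_monom 1 []"
  "f \<oplus>\<^bsub>free_alg n\<^esub> g = (\<lambda>w. f w + g w)"
  "f \<otimes>\<^bsub>free_alg n\<^esub> g = (\<lambda>w. \<Sum>m\<le>length w. f (take m w) * g (drop m w))"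
  by (simp_all add: free_alg_def word_monom_def)

lemma free_alg_carrierI:
  "finite A \<Longrightarrow> A \<subseteq> lists {1..<n} \<Longrightarrow> (\<And>w. f w \<noteq> 0 \<Longrightarrow> w \<in> A) \<Longrightarrow> f \<in> carrier (free_alg n)"
  unfolding free_alg_carrier_iff by (auto intro: finite_subset)

lemma word_monom_carrier: "w \<in> lists {1..<n} \<Longrightarrow> word_monom c w \<in> carrier (free_alg n)"
  by (rule free_alg_carrierI[of "{w}"]) (auto simp: word_monom_def split: if_splits)

lemma free_alg_add_carrier:
  assumes "f \<in> carrier (free_alg n)" "g \<in> carrier (free_alg n)"
  shows "(\<lambda>w. f w + g w) \<in> carrier (free_alg n)"
  by (rule free_alg_carrierI[of "{w. f w \<noteq> 0} \<union> {w. g w \<noteq> 0}"])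
    (use assms in \<open>auto simp: free_alg_carrier_iff\<close>)

lemma free_alg_mult_carrier:
  assumes "f \<in> carrier (free_alg n)" "g \<in> carrier (free_alg n)"
  shows "f \<otimes>\<^bsub>free_alg n\<^esub> g \<in> carrier (free_alg n)"
proof (rule free_alg_carrierI[of "(\<lambda>(u, v). u @ v) ` ({w. f w \<noteq> 0} \<times> {w. g w \<noteq> 0})"])
  fix w assume "(f \<otimes>\<^bsub>free_alg n\<^esub> g) w \<noteq> 0"
  then obtain m where "f (take m w) * g (drop m w) \<noteq> 0"
    unfolding free_alg_simps by (meson sum.not_neutral_contains_not_neutral)
  then show "w \<in> (\<lambda>(u, v). u @ v) ` ({w. f w \<noteq> 0} \<times> {w. g w \<noteq> 0})"
    by (intro image_eqI[of _ _ "(take m w, drop m w)"]) auto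
next
  show "(\<lambda>(u, v). u @ v) ` ({w. f w \<noteq> 0} \<times> {w. g w \<noteq> 0}) \<subseteq> lists {1..<n}"
  proof (rule subsetI)
    fix w assume "w \<in> (\<lambda>(u, v). u @ v) ` ({w. f w \<noteq> 0} \<times> {w. g w \<noteq> 0})"
    then obtain u v where "w = u @ v" "f u \<noteq> 0" "g v \<noteq> 0"
      by auto
    moreover from this have "u \<in> lists {1..<n}" "v \<in> lists {1..<n}"
      using assms unfolding free_alg_carrier_iff by blast+
    ultimately show "w \<in> lists {1..<n}"
      by simp
  qed
qed (use assms in \<open>auto simp: free_alg_carrier_iff\<close>)

text \<open>Both sides sum over the splittings of \<open>w\<close> into three consecutive pieces, of
  lengths \<open>a\<close>, \<open>b\<close>, \<open>c\<close> in \<open>T\<close>; the reindexing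
  is that of triple Cauchy products of power series.\<close>

lemma free_alg_mult_assoc:
  "(f \<otimes>\<^bsub>free_alg n\<^esub> g) \<otimes>\<^bsub>free_alg n\<^esub> h = f \<otimes>\<^bsub>free_alg n\<^esub> (g \<otimes>\<^bsub>free_alg n\<^esub> h)"
proof
  fix w :: "nat list"
  let ?N = "length w"
  define T where "T a b c = f (take a w) * g (take b (drop a w)) * h (drop (?N - c) w)" for a b c
  have "((f \<otimes>\<^bsub>free_alg n\<^esub> g) \<otimes>\<^bsub>free_alg n\<^esub> h) w = (\<Sum>j=0..?N. \<Sum>i=0..j. T i (j - i) (?N - j))"
    unfolding free_alg_simps atLeast0AtMost sum_distrib_right T_def
    by (intro sum.cong) (auto simp: min_def drop_take)
  also have "\<dots> = (\<Sum>j=0..?N. \<Sum>i=0..?N - j. T j i (?N - j - i))"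
    by (rule fps_mult_assoc_lemma)
  also have "\<dots> = (f \<otimes>\<^bsub>free_alg n\<^esub> (g \<otimes>\<^bsub>free_alg n\<^esub> h)) w"
    unfolding free_alg_simps atLeast0AtMost sum_distrib_left T_def
    by (intro sum.cong) (auto simp: mult.assoc add.commute)
  finally show "((f \<otimes>\<^bsub>free_alg n\<^esub> g) \<otimes>\<^bsub>free_alg n\<^esub> h) w = (f \<otimes>\<^bsub>free_alg n\<^esub> (g \<otimes>\<^bsub>free_alg n\<^esub> h)) w" .
qed

lemma word_monom_mult:
  "word_monom c u \<otimes>\<^bsub>free_alg n\<^esub> word_monom d v = word_monom (c * d) (u @ v)"
proof
  fix w
  have iff: "take m w = u \<and> drop m w = v \<longleftrightarrow> m = length u \<and> w = u @ v" if "m \<le> length w" for m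
    using that by (metis append_eq_conv_conj append_take_drop_id length_take min.absorb2)
  have "(word_monom c u \<otimes>\<^bsub>free_alg n\<^esub> word_monom d v) w =
      (\<Sum>m\<le>length w. if m = length u then if w = u @ v then c * d else 0 else 0)"
    unfolding free_alg_simps
  proof (rule sum.cong[OF HOL.refl])
    fix m assume "m \<in> {..length w}"
    then have "word_monom c u (take m w) * word_monom d v (drop m w) =
        (if m = length u \<and> w = u @ v then c * d else 0)"
      unfolding word_monom_def by (subst iff[symmetric]) auto
    then show "word_monom c u (take m w) * word_monom d v (drop m w) =
        (if m = length u then if w = u @ v then c * d else 0 else 0)"
      by simp
  qed
  also have "\<dots> = word_monom (c * d) (u @ v) w"
    by (auto simp: word_monom_def)
  finally show "(word_monom c u \<otimes>\<^bsub>free_alg n\<^esub> word_monom d v) w = word_monom (c * d) (u @ v) w" .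
qed

lemma free_alg_one_mult:
  "word_monom 1 [] \<otimes>\<^bsub>free_alg n\<^esub> f = f" "f \<otimes>\<^bsub>free_alg n\<^esub> word_monom 1 [] = f"
proof -
  show "word_monom 1 [] \<otimes>\<^bsub>free_alg n\<^esub> f = f"
  proof
    fix w
    have "(\<Sum>m\<le>length w. word_monom 1 [] (take m w) * f (drop m w)) =
        (\<Sum>m\<le>length w. if m = 0 then f w else 0)"
      by (intro sum.cong) (auto simp: word_monom_def)
    then show "(word_monom 1 [] \<otimes>\<^bsub>free_alg n\<^esub> f) w = f w"
      by (simp add: free_alg_simps)
  qed
  show "f \<otimes>\<^bsub>free_alg n\<^esub> word_monom 1 [] = f"
  proof
    fix w
    have "(\<Sum>m\<le>length w. f (take m w) * word_monom 1 [] (drop m w)) =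
        (\<Sum>m\<le>length w. if m = length w then f w else 0)"
      by (intro sum.cong) (auto simp: word_monom_def)
    then show "(f \<otimes>\<^bsub>free_alg n\<^esub> word_monom 1 []) w = f w"
      by (simp add: free_alg_simps)
  qed
qed

lemma ring_free_alg: "ring (free_alg n :: (nat list \<Rightarrow> 'a::field) ring)" (is "ring ?F")
proof (rule ringI)
  show "abelian_group ?F"
  proof (rule abelian_groupI)
    fix f :: "nat list \<Rightarrow> 'a" assume "f \<in> carrier ?F"
    then have "(\<lambda>w. - f w) \<in> carrier ?F"
      by (simp add: free_alg_carrier_iff)
    then show "\<exists>g\<in>carrier ?F. g \<oplus>\<^bsub>?F\<^esub> f = \<zero>\<^bsub>?F\<^esub>"
      by (intro bexI[of _ "\<lambda>w. - f w"]) (simp add: free_alg_simps)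
  qed (auto simp: free_alg_simps free_alg_add_carrier add.assoc add.commute free_alg_carrier_iff[of "\<lambda>_. 0"])
  show "monoid ?F"
  proof (rule monoidI)
    show "\<one>\<^bsub>?F\<^esub> \<in> carrier ?F"
      unfolding free_alg_simps by (rule word_monom_carrier) simp
    show "\<one>\<^bsub>?F\<^esub> \<otimes>\<^bsub>?F\<^esub> f = f" "f \<otimes>\<^bsub>?F\<^esub> \<one>\<^bsub>?F\<^esub> = f" for f
      unfolding free_alg_simps(2) by (rule free_alg_one_mult)+
  qed (simp_all add: free_alg_mult_carrier free_alg_mult_assoc)
qed (simp_all add: free_alg_simps fun_eq_iff algebra_simps sum.distrib)

lemma free_alg_induct [consumes 1, case_names zero add]:
  assumes "f \<in> carrier (free_alg n)"
    and "P (\<lambda>w. 0)"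
    and "\<And>f c w. f \<in> carrier (free_alg n) \<Longrightarrow> w \<in> lists {1..<n} \<Longrightarrow> P f \<Longrightarrow>
      P (f \<oplus>\<^bsub>free_alg n\<^esub> word_monom c w)"
  shows "P f"
proof -
  have "f \<in> carrier (free_alg n) \<Longrightarrow> {w. f w \<noteq> 0} \<subseteq> A \<Longrightarrow> P f" if "finite A" for A
    using that
  proof (induction A arbitrary: f)
    case empty
    then have "f = (\<lambda>w. 0)"
      by auto
    then show ?case
      using assms(2) by simp
  next
    case (insert v A)
    show ?case
    proof (cases "f v = 0")
      case True
      then show ?thesis
        using insert by (intro insert.IH) auto
    next
      case False
      then have v: "v \<in> lists {1..<n}"
        using insert.prems(1) by (auto simp: free_alg_carrier_iff)
      let ?g = "f(v := 0)"
      have g: "?g \<in> carrier (free_alg n)"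
        by (rule free_alg_carrierI[of "{w. f w \<noteq> 0}"])
          (use insert.prems(1) in \<open>auto simp: free_alg_carrier_iff split: if_splits\<close>)
      moreover have "{w. ?g w \<noteq> 0} \<subseteq> A"
        using insert.prems(2) by auto
      ultimately have "P ?g"
        by (rule insert.IH)
      then have "P (?g \<oplus>\<^bsub>free_alg n\<^esub> word_monom (f v) v)"
        using g v assms(3) by blast
      also have "?g \<oplus>\<^bsub>free_alg n\<^esub> word_monom (f v) v = f"
        by (auto simp: free_alg_simps word_monom_def)
      finally show ?thesis .
    qed
  qed
  then show ?thesis
    using assms(1) by (auto simp: free_alg_carrier_iff)
qed

section \<open>The linear extension of \<open>word_mat\<close> to the free algebra\<close>

definition free_rep :: "nat \<Rightarrow> nat \<Rightarrow> (nat list \<Rightarrow> 'a::field) \<Rightarrow> 'a mat" where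
  "free_rep n p f = mat (p ^ n) (p ^ n) (\<lambda>(a, b). \<Sum>w | f w \<noteq> 0. f w * word_mat n p w $$ (a, b))"

lemma free_rep_carrier: "free_rep n p f \<in> carrier_mat (p ^ n) (p ^ n)"
  by (simp add: free_rep_def)

lemma free_rep_index:
  assumes "finite A" "\<And>w. f w \<noteq> 0 \<Longrightarrow> w \<in> A" "a < p ^ n" "b < p ^ n"
  shows "free_rep n p f $$ (a, b) = (\<Sum>w\<in>A. f w * word_mat n p w $$ (a, b))"
  using assms by (auto simp: free_rep_def intro!: sum.mono_neutral_left)

lemma free_rep_zero: "free_rep n p (\<lambda>w. 0) = 0\<^sub>m (p ^ n) (p ^ n)"
  by (rule eq_matI) (auto simp: free_rep_def)

lemma free_rep_add:
  assumes "f \<in> carrier (free_alg n)" "g \<in> carrier (free_alg n)"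
  shows "free_rep n p (f \<oplus>\<^bsub>free_alg n\<^esub> g) = free_rep n p f + free_rep n p g"
proof (rule eq_matI)
  let ?A = "{w. f w \<noteq> 0} \<union> {w. g w \<noteq> 0}"
  have A: "finite ?A"
    using assms by (simp add: free_alg_carrier_iff)
  fix a b assume "a < dim_row (free_rep n p f + free_rep n p g)" "b < dim_col (free_rep n p f + free_rep n p g)"
  then have ab: "a < p ^ n" "b < p ^ n"
    by (simp_all add: free_rep_def)
  have "(free_rep n p f + free_rep n p g) $$ (a, b) = free_rep n p f $$ (a, b) + free_rep n p g $$ (a, b)"
    using ab by (simp add: free_rep_def)
  moreover have "free_rep n p f $$ (a, b) = (\<Sum>w\<in>?A. f w * word_mat n p w $$ (a, b))"
    "free_rep n p g $$ (a, b) = (\<Sum>w\<in>?A. g w * word_mat n p w $$ (a, b))"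
    "free_rep n p (f \<oplus>\<^bsub>free_alg n\<^esub> g) $$ (a, b) =
      (\<Sum>w\<in>?A. (f \<oplus>\<^bsub>free_alg n\<^esub> g) w * word_mat n p w $$ (a, b))"
    by (rule free_rep_index[OF A _ ab], force simp: free_alg_simps)+
  ultimately show "free_rep n p (f \<oplus>\<^bsub>free_alg n\<^esub> g) $$ (a, b) = (free_rep n p f + free_rep n p g) $$ (a, b)"
    by (simp add: free_alg_simps sum.distrib distrib_right)
qed (simp_all add: free_rep_def)

lemma free_rep_word_monom:
  assumes "w \<in> lists {1..<n}"
  shows "free_rep n p (word_monom c w) = c \<cdot>\<^sub>m word_mat n p w"
proof (rule eq_matI)
  note dims = carrier_matD[OF word_mat_carrier[OF assms]]
  fix a b assume "a < dim_row (c \<cdot>\<^sub>m word_mat n p w)" "b < dim_col (c \<cdot>\<^sub>m word_mat n p w)"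
  then have ab: "a < p ^ n" "b < p ^ n"
    by (simp_all add: dims)
  show "free_rep n p (word_monom c w) $$ (a, b) = (c \<cdot>\<^sub>m word_mat n p w) $$ (a, b)"
    using ab by (subst free_rep_index[of "{w}"]) (auto simp: word_monom_def dims split: if_splits)
qed (simp_all add: free_rep_def carrier_matD[OF word_mat_carrier[OF assms]])

lemma free_rep_one: "free_rep n p (word_monom 1 []) = 1\<^sub>m (p ^ n)"
  by (subst free_rep_word_monom) auto

text \<open>By bilinearity each factor is built up one monomial at a time; on two monomials the
  claim is \<open>word_mat_append\<close>.\<close>

lemma free_rep_mult:
  assumes f: "f \<in> carrier (free_alg n)" and g: "g \<in> carrier (free_alg n)"
  shows "free_rep n p (f \<otimes>\<^bsub>free_alg n\<^esub> g) = free_rep n p f * free_rep n p g"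
proof -
  interpret ring "free_alg n :: (nat list \<Rightarrow> 'a) ring"
    by (rule ring_free_alg)
  have zero: "(\<lambda>w. 0) = \<zero>\<^bsub>free_alg n\<^esub>"
    by (simp add: free_alg_simps)
  have monom: "free_rep n p (word_monom c u \<otimes>\<^bsub>free_alg n\<^esub> g) = free_rep n p (word_monom c u) * free_rep n p g"
    if u: "u \<in> lists {1..<n}" for c u
    using g
  proof (induction rule: free_alg_induct)
    case zero
    then show ?case
      using free_rep_carrier[of n p "word_monom c u"] u
      by (simp add: \<open>(\<lambda>w. 0) = _\<close> word_monom_carrier) (simp add: free_rep_zero flip: \<open>(\<lambda>w. 0) = _\<close>)
  next
    case (add g d v)
    have uv: "u @ v \<in> lists {1..<n}"
      using u add(2) by simp
    have "free_rep n p (word_monom c u \<otimes>\<^bsub>free_alg n\<^esub> (g \<oplus>\<^bsub>free_alg n\<^esub> word_monom d v)) =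
        free_rep n p (word_monom c u \<otimes>\<^bsub>free_alg n\<^esub> g \<oplus>\<^bsub>free_alg n\<^esub> word_monom c u \<otimes>\<^bsub>free_alg n\<^esub> word_monom d v)"
      using add u by (simp add: r_distr word_monom_carrier)
    also have "\<dots> = free_rep n p (word_monom c u) * free_rep n p g + free_rep n p (word_monom (c * d) (u @ v))"
      using add u uv by (simp add: free_rep_add word_monom_mult word_monom_carrier free_alg_mult_carrier)
    also have "free_rep n p (word_monom (c * d) (u @ v)) = free_rep n p (word_monom c u) * free_rep n p (word_monom d v)"
    proof -
      have "word_mat n p u * (word_mat n p v :: 'a mat) = word_mat n p (u @ v)"
        by (rule word_mat_append[OF u add(2), symmetric])
      then show ?thesis
        using word_mat_carrier[OF u, where 'a = 'a, of p] word_mat_carrier[OF add(2), where 'a = 'a, of p]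
        unfolding free_rep_word_monom[OF u] free_rep_word_monom[OF uv] free_rep_word_monom[OF add(2)]
        by (simp add: mult_smult_assoc_mat[of _ "p ^ n" "p ^ n" _ "p ^ n"]
            mult_smult_distrib[of _ "p ^ n" "p ^ n" _ "p ^ n"])
            (rule eq_matI; simp add: mult.assoc)
    qed
    also have "free_rep n p (word_monom c u) * free_rep n p g + free_rep n p (word_monom c u) * free_rep n p (word_monom d v) =
        free_rep n p (word_monom c u) * free_rep n p (g \<oplus>\<^bsub>free_alg n\<^esub> word_monom d v)"
      using add by (simp add: free_rep_add word_monom_carrier mult_add_distrib_mat[OF free_rep_carrier free_rep_carrier free_rep_carrier])
    finally show ?case .
  qed
  show ?thesis
    using f
  proof (induction rule: free_alg_induct)
    case zero
    then show ?case
      using free_rep_carrier[of n p g] g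
      by (simp add: \<open>(\<lambda>w. 0) = _\<close>) (simp add: free_rep_zero flip: \<open>(\<lambda>w. 0) = _\<close>)
  next
    case (add f c u)
    then show ?case
      using g by (simp add: l_distr word_monom_carrier free_rep_add free_alg_mult_carrier monom
          add_mult_distrib_mat[OF free_rep_carrier free_rep_carrier free_rep_carrier])
  qed
qed

lemma free_rep_hom:
  "ring_hom_ring (free_alg n) (ring_mat TYPE('a::field) (p ^ n) ()) (free_rep n p)"
proof (rule ring_hom_ringI)
  show "ring (free_alg n :: (nat list \<Rightarrow> 'a) ring)"
    by (rule ring_free_alg)
  show "ring (ring_mat TYPE('a) (p ^ n) ())"
    by (rule ring_mat)
  show "free_rep n p \<one>\<^bsub>free_alg n\<^esub> = \<one>\<^bsub>ring_mat TYPE('a) (p ^ n) ()\<^esub>"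
    unfolding free_alg_simps free_rep_one ring_mat_simps ..
qed (simp_all add: ring_mat_simps free_rep_carrier free_rep_mult free_rep_add)


section \<open>The Temperley-Lieb algebra\<close>

lemma (in ring_hom_ring) hom_minus_eq_zero_iff:
  assumes "x \<in> carrier R" "y \<in> carrier R"
  shows "h (x \<ominus> y) = \<zero>\<^bsub>S\<^esub> \<longleftrightarrow> h x = h y"
proof -
  have "h (x \<ominus> y) = h x \<ominus>\<^bsub>S\<^esub> h y"
    using assms by (simp only: a_minus_def hom_add hom_a_inv R.a_inv_closed)
  then show ?thesis
    using ring.r_right_minus_eq[OF S.ring_axioms hom_closed[OF assms(1)] hom_closed[OF assms(2)]] by simp
qed

lemma tl_relations_carrier: "tl_relations n p \<subseteq> carrier (free_alg n :: (nat list \<Rightarrow> 'a::field) ring)"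
proof -
  interpret ring "free_alg n :: (nat list \<Rightarrow> 'a) ring"
    by (rule ring_free_alg)
  show ?thesis
    unfolding tl_relations_def by (auto intro!: minus_closed word_monom_carrier)
qed

lemma tl_ideal_ideal: "ideal (tl_ideal n p) (free_alg n :: (nat list \<Rightarrow> 'a::field) ring)"
  unfolding tl_ideal_def by (rule ring.genideal_ideal[OF ring_free_alg tl_relations_carrier])

lemma ring_tl_alg: "ring (tl_alg n p :: (nat list \<Rightarrow> 'a::field) set ring)"
  unfolding tl_alg_def by (rule ideal.quotient_is_ring[OF tl_ideal_ideal])

lemma tl_class_hom: "ring_hom_ring (free_alg n) (tl_alg n p) (tl_class n p :: (nat list \<Rightarrow> 'a::field) \<Rightarrow> _)"
proof (rule ring_hom_ringI2[OF ring_free_alg ring_tl_alg])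
  have "tl_class n p = (+>\<^bsub>free_alg n\<^esub>) (tl_ideal n p :: (nat list \<Rightarrow> 'a) set)"
    by (simp add: fun_eq_iff tl_class_def)
  then show "(tl_class n p :: (nat list \<Rightarrow> 'a) \<Rightarrow> _) \<in> ring_hom (free_alg n) (tl_alg n p)"
    unfolding tl_alg_def using ideal.rcos_ring_hom[OF tl_ideal_ideal] by metis
qed

lemma tl_class_eq_zero_iff:
  assumes "f \<in> carrier (free_alg n)"
  shows "tl_class n p f = \<zero>\<^bsub>tl_alg n p\<^esub> \<longleftrightarrow> f \<in> tl_ideal n p"
proof -
  interpret ideal "tl_ideal n p" "free_alg n :: (nat list \<Rightarrow> 'a) ring"
    by (rule tl_ideal_ideal)
  have "\<zero>\<^bsub>tl_alg n p\<^esub> = (tl_ideal n p :: (nat list \<Rightarrow> 'a) set)"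
    by (simp add: tl_alg_def FactRing_def)
  then show ?thesis
    unfolding tl_class_def using assms a_rcos_const rcos_const_imp_mem by metis
qed

lemma tl_class_eq_iff:
  assumes "f \<in> carrier (free_alg n)" "g \<in> carrier (free_alg n)"
  shows "tl_class n p f = tl_class n p g \<longleftrightarrow> f \<ominus>\<^bsub>free_alg n\<^esub> g \<in> tl_ideal n p"
  using ring_hom_ring.hom_minus_eq_zero_iff[OF tl_class_hom assms, of p]
    tl_class_eq_zero_iff[OF abelian_group.minus_closed[OF ring.is_abelian_group[OF ring_free_alg] assms], of p] by simp

lemma tl_relations_comm:
  "i \<in> {1..<n} \<Longrightarrow> j \<in> {1..<n} \<Longrightarrow> j + 2 \<le> i \<Longrightarrow>
    word_monom 1 [i, j] \<ominus>\<^bsub>free_alg n\<^esub> word_monom 1 [j, i] \<in> tl_relations n p"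
  unfolding tl_relations_def by blast

lemma tl_relations_braid:
  "i \<in> {1..<n} \<Longrightarrow> j \<in> {1..<n} \<Longrightarrow> j = i + 1 \<or> i = j + 1 \<Longrightarrow>
    word_monom 1 [i, j, i] \<ominus>\<^bsub>free_alg n\<^esub> word_monom 1 [i] \<in> tl_relations n p"
  unfolding tl_relations_def by blast

lemma tl_relations_idem:
  "i \<in> {1..<n} \<Longrightarrow>
    word_monom 1 [i, i] \<ominus>\<^bsub>free_alg n\<^esub> word_monom (of_nat p) [i] \<in> tl_relations n p"
  unfolding tl_relations_def by blast

lemma tl_class_relation:
  assumes "f \<ominus>\<^bsub>free_alg n\<^esub> g \<in> tl_relations n p" "f \<in> carrier (free_alg n)" "g \<in> carrier (free_alg n)"
  shows "tl_class n p f = tl_class n p g"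
  using assms ring.genideal_self[OF ring_free_alg tl_relations_carrier[of n p, where 'a = 'a]]
  by (subst tl_class_eq_iff) (auto simp: tl_ideal_def)

lemma tl_class_mult:
  assumes "f \<in> carrier (free_alg n)" "g \<in> carrier (free_alg n)"
  shows "tl_class n p (f \<otimes>\<^bsub>free_alg n\<^esub> g) = tl_class n p f \<otimes>\<^bsub>tl_alg n p\<^esub> tl_class n p g"
  using ring_hom_mult[OF ring_hom_ring.homh[OF tl_class_hom]] assms by blast

lemma tl_class_add:
  assumes "f \<in> carrier (free_alg n)" "g \<in> carrier (free_alg n)"
  shows "tl_class n p (f \<oplus>\<^bsub>free_alg n\<^esub> g) = tl_class n p f \<oplus>\<^bsub>tl_alg n p\<^esub> tl_class n p g"
  using ring_hom_add[OF ring_hom_ring.homh[OF tl_class_hom]] assms by blast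

lemma tl_class_word_monom_append:
  assumes "u \<in> lists {1..<n}" "v \<in> lists {1..<n}"
  shows "tl_class n p (word_monom (c * d) (u @ v)) =
    tl_class n p (word_monom c u) \<otimes>\<^bsub>tl_alg n p\<^esub> tl_class n p (word_monom d v)"
  unfolding tl_class_mult[OF word_monom_carrier[OF assms(1)] word_monom_carrier[OF assms(2)], symmetric]
    word_monom_mult ..

lemma tl_class_scale:
  assumes "u \<in> lists {1..<n}" "v \<in> lists {1..<n}"
    and "tl_class n p (word_monom c u) = tl_class n p (word_monom d v)"
  shows "tl_class n p (word_monom (b * c) u) = tl_class n p (word_monom (b * d) v)"
  using tl_class_word_monom_append[of "[]" n u p b c] tl_class_word_monom_append[of "[]" n v p b d] assms by simp

text \<open>Each use of \<open>red_idem\<close> costs one factor \<open>p\<close>, the other rules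
  none; exponents add up under transitivity and concatenation.\<close>

lemma red_tl_class:
  assumes "red u v" "u \<in> lists {1..<n}"
  shows "\<exists>e. tl_class n p (word_monom 1 u) = tl_class n p (word_monom (of_nat p ^ e :: 'a::field) v)"
  using assms
proof (induction rule: red.induct)
  case (red_comm j i)
  then have w: "[i, j] \<in> lists {1..<n}" "[j, i] \<in> lists {1..<n}"
    by auto
  have "tl_class n p (word_monom (1 :: 'a) [i, j]) = tl_class n p (word_monom 1 [j, i])"
  proof (cases "j + 2 \<le> i")
    case True
    then show ?thesis
      using red_comm by (intro tl_class_relation tl_relations_comm word_monom_carrier w) auto
  next
    case False
    then show ?thesis
      using red_comm by (intro tl_class_relation[symmetric] tl_relations_comm word_monom_carrier w) auto
  qed
  then show ?case
    by (intro exI[of _ 0]) simp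
next
  case (red_braid j i)
  then have "tl_class n p (word_monom (1 :: 'a) [i, j, i]) = tl_class n p (word_monom 1 [i])"
    by (intro tl_class_relation tl_relations_braid word_monom_carrier) auto
  then show ?case
    by (intro exI[of _ 0]) simp
next
  case (red_idem i)
  then have "tl_class n p (word_monom (1 :: 'a) [i, i]) = tl_class n p (word_monom (of_nat p) [i])"
    by (intro tl_class_relation tl_relations_idem word_monom_carrier) auto
  then show ?case
    by (intro exI[of _ 1]) simp
next
  case (red_refl w)
  then show ?case
    by (intro exI[of _ 0]) simp
next
  case (red_trans u v w)
  have v: "v \<in> lists {1..<n}"
    using red_set[OF red_trans.hyps(1)] red_trans.prems by blast
  have w: "w \<in> lists {1..<n}"
    using red_set[OF red_trans.hyps(2)] v by blast
  obtain e where e: "tl_class n p (word_monom 1 u) = tl_class n p (word_monom (of_nat p ^ e :: 'a) v)"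
    using red_trans by blast
  obtain e' where e': "tl_class n p (word_monom 1 v) = tl_class n p (word_monom (of_nat p ^ e' :: 'a) w)"
    using red_trans v by blast
  show ?case
    using e tl_class_scale[OF v w e', of "of_nat p ^ e"] by (intro exI[of _ "e + e'"]) (simp add: power_add)
next
  case (red_append u v u' v')
  have u: "u \<in> lists {1..<n}" "u' \<in> lists {1..<n}"
    using red_append.prems by auto
  have v: "v \<in> lists {1..<n}" "v' \<in> lists {1..<n}"
    using red_set[OF red_append.hyps(1)] red_set[OF red_append.hyps(2)] u by blast+
  obtain e where e: "tl_class n p (word_monom 1 u) = tl_class n p (word_monom (of_nat p ^ e :: 'a) v)"
    using red_append u by blast
  obtain e' where e': "tl_class n p (word_monom 1 u') = tl_class n p (word_monom (of_nat p ^ e' :: 'a) v')"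
    using red_append u by blast
  show ?case
    using tl_class_word_monom_append[OF u, of p 1 "1 :: 'a"]
      tl_class_word_monom_append[OF v, of p "of_nat p ^ e" "of_nat p ^ e' :: 'a"] e e'
    by (intro exI[of _ "e + e'"]) (simp add: power_add)
qed

text \<open>Fixing the irrelevant values of \<open>k\<close> makes normal forms correspond to functions one to one.\<close>

definition nf_set :: "nat \<Rightarrow> (nat \<Rightarrow> nat) set" where
  "nf_set n = {k. is_nf n k \<and> (\<forall>i. i \<notin> {1..<n} \<longrightarrow> k i = 0)}"

lemma finite_nf_set: "finite (nf_set n)"
proof (rule finite_subset)
  show "nf_set n \<subseteq> {k. \<forall>i. (i \<in> {1..<n} \<longrightarrow> k i \<in> {..n}) \<and> (i \<notin> {1..<n} \<longrightarrow> k i = 0)}"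
    by (fastforce simp: nf_set_def dest: is_nf_le)
qed (intro finite_set_of_finite_funs, simp_all)

lemma nf_set_normalize:
  assumes "is_nf n k"
  obtains k' where "k' \<in> nf_set n" "nf_word n k' = nf_word n k"
proof
  let ?k = "\<lambda>i. if i \<in> {1..<n} then k i else 0"
  show "?k \<in> nf_set n"
    using assms by (auto simp: nf_set_def is_nf_def)
  show "nf_word n ?k = nf_word n k"
    by (rule nf_word_cong) simp
qed

section \<open>Spanning by normal forms and the kernel of the representation\<close>

definition nf_comb :: "nat \<Rightarrow> ((nat \<Rightarrow> nat) \<Rightarrow> 'a::field) \<Rightarrow> nat list \<Rightarrow> 'a" where
  "nf_comb n c w = (\<Sum>k\<in>nf_set n. word_monom (c k) (nf_word n k) w)"

lemma nf_comb_nonzero: "nf_comb n c w \<noteq> 0 \<Longrightarrow> w \<in> nf_word n ` nf_set n"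
  unfolding nf_comb_def by (erule sum.not_neutral_contains_not_neutral) (auto simp: word_monom_def split: if_splits)

lemma nf_comb_carrier: "nf_comb n c \<in> carrier (free_alg n)"
proof (rule free_alg_carrierI)
  show "nf_word n ` nf_set n \<subseteq> lists {1..<n}"
    by (rule image_subsetI, rule nf_word_lists) (simp add: nf_set_def)
qed (simp_all only: finite_imageI finite_nf_set nf_comb_nonzero)

lemma nf_comb_add_monom:
  assumes "k \<in> nf_set n"
  shows "nf_comb n c \<oplus>\<^bsub>free_alg n\<^esub> word_monom d (nf_word n k) = nf_comb n (c(k := c k + d))"
proof
  fix w
  let ?c = "c(k := c k + d)"
  define S where "S = (\<Sum>k'\<in>nf_set n - {k}. word_monom (c k') (nf_word n k') w)"
  have "nf_comb n c w = word_monom (c k) (nf_word n k) w + S"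
    unfolding nf_comb_def S_def by (rule sum.remove[OF finite_nf_set assms])
  moreover have "nf_comb n ?c w = word_monom (?c k) (nf_word n k) w +
      (\<Sum>k'\<in>nf_set n - {k}. word_monom (?c k') (nf_word n k') w)"
    unfolding nf_comb_def by (rule sum.remove[OF finite_nf_set assms])
  moreover have "(\<Sum>k'\<in>nf_set n - {k}. word_monom (?c k') (nf_word n k') w) = S"
    unfolding S_def by (intro sum.cong) auto
  ultimately show "(nf_comb n c \<oplus>\<^bsub>free_alg n\<^esub> word_monom d (nf_word n k)) w = nf_comb n ?c w"
    by (simp add: free_alg_simps word_monom_def)
qed

text \<open>Modulo the ideal every word is a power of \<open>p\<close> times a normal form, so each
  added monomial changes a single coefficient.\<close>

lemma tl_class_nf_comb:
  fixes f :: "nat list \<Rightarrow> 'a::field"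
  assumes "f \<in> carrier (free_alg n)" "n \<ge> 1"
  shows "\<exists>c. tl_class n p f = tl_class n p (nf_comb n c)"
  using assms(1)
proof (induction rule: free_alg_induct)
  case zero
  have "nf_comb n (\<lambda>_. 0 :: 'a) = (\<lambda>w. 0)"
    by (simp add: nf_comb_def word_monom_def fun_eq_iff)
  then show ?case
    by (intro exI[of _ "\<lambda>_. 0"]) simp
next
  case (add f d w)
  then obtain c where c: "tl_class n p f = tl_class n p (nf_comb n c)"
    by blast
  obtain k0 where "is_nf n k0" "red w (nf_word n k0)"
    using red_nf[OF add(2) assms(2)] by blast
  then obtain k where k: "k \<in> nf_set n" "red w (nf_word n k)"
    using nf_set_normalize by metis
  then have nf: "nf_word n k \<in> lists {1..<n}"
    by (intro nf_word_lists) (simp add: nf_set_def)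
  obtain e where "tl_class n p (word_monom 1 w) = tl_class n p (word_monom (of_nat p ^ e :: 'a) (nf_word n k))"
    using red_tl_class k(2) add(2) by blast
  then have e: "tl_class n p (word_monom d w) = tl_class n p (word_monom (d * of_nat p ^ e) (nf_word n k))"
    using tl_class_scale[OF add(2) nf, of p 1 _ d] by simp
  have "tl_class n p (f \<oplus>\<^bsub>free_alg n\<^esub> word_monom d w) =
      tl_class n p (nf_comb n c \<oplus>\<^bsub>free_alg n\<^esub> word_monom (d * of_nat p ^ e) (nf_word n k))"
    using add(1,2) nf by (simp add: tl_class_add word_monom_carrier nf_comb_carrier c e)
  then show ?case
    using nf_comb_add_monom[OF k(1)] by metis
qed

lemma free_rep_nf_comb:
  assumes "p \<ge> 2" "a < p ^ n" "b < p ^ n"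
  shows "free_rep n p (nf_comb n c) $$ (a, b) = (\<Sum>k\<in>nf_set n. c k * of_bool (nf_entry n p k a b))"
proof -
  let ?A = "nf_word n ` nf_set n"
  have A: "finite ?A"
    using finite_nf_set by simp
  have "free_rep n p (nf_comb n c) $$ (a, b) = (\<Sum>w\<in>?A. nf_comb n c w * word_mat n p w $$ (a, b))"
    by (rule free_rep_index[OF A nf_comb_nonzero assms(2,3)])
  also have "\<dots> = (\<Sum>w\<in>?A. \<Sum>k\<in>nf_set n. word_monom (c k) (nf_word n k) w * word_mat n p w $$ (a, b))"
    by (simp add: nf_comb_def sum_distrib_right)
  also have "\<dots> = (\<Sum>k\<in>nf_set n. \<Sum>w\<in>?A. word_monom (c k) (nf_word n k) w * word_mat n p w $$ (a, b))"
    by (rule sum.swap)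
  also have "\<dots> = (\<Sum>k\<in>nf_set n. c k * of_bool (nf_entry n p k a b))"
  proof (rule sum.cong[OF HOL.refl])
    fix k assume k: "k \<in> nf_set n"
    have "(\<Sum>w\<in>?A. word_monom (c k) (nf_word n k) w * word_mat n p w $$ (a, b)) =
        (\<Sum>w\<in>?A. if w = nf_word n k then c k * word_mat n p w $$ (a, b) else 0)"
      by (intro sum.cong) (auto simp: word_monom_def)
    also have "\<dots> = c k * word_mat n p (nf_word n k) $$ (a, b)"
      using A k by simp
    also have "word_mat n p (nf_word n k) $$ (a, b) = (of_bool (nf_entry n p k a b) :: 'a)"
      using k by (intro word_mat_nf_word assms) (simp add: nf_set_def)
    finally show "(\<Sum>w\<in>?A. word_monom (c k) (nf_word n k) w * word_mat n p w $$ (a, b)) =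
        c k * of_bool (nf_entry n p k a b)" .
  qed
  finally show ?thesis .
qed

lemma nf_set_distinct:
  assumes "k \<in> nf_set n" "k' \<in> nf_set n" "k \<noteq> k'"
  shows "\<exists>i\<in>{1..<n}. k i \<noteq> k' i"
proof -
  obtain i where i: "k i \<noteq> k' i"
    using assms(3) by (meson ext)
  have "k i = 0" "k' i = 0" if "i \<notin> {1..<n}"
    using assms(1,2) that unfolding nf_set_def by blast+
  then show ?thesis
    using i by metis
qed

text \<open>The kernel is a two-sided ideal, so it suffices that the matrices satisfy the generating
  relations.\<close>

lemma tl_ideal_free_rep:
  assumes "p \<ge> 2" "f \<in> tl_ideal n p"
  shows "free_rep n p f = (0\<^sub>m (p ^ n) (p ^ n) :: 'a::field mat)"
proof -
  let ?M = "ring_mat TYPE('a) (p ^ n) ()"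
  interpret h: ring_hom_ring "free_alg n" ?M "free_rep n p"
    by (rule free_rep_hom)
  have minus: "f \<ominus>\<^bsub>free_alg n\<^esub> g \<in> a_kernel (free_alg n) ?M (free_rep n p)"
    if "f \<in> carrier (free_alg n)" "g \<in> carrier (free_alg n)" "free_rep n p f = free_rep n p g" for f g :: "nat list \<Rightarrow> 'a"
    using h.hom_minus_eq_zero_iff[OF that(1,2)] h.R.minus_closed[OF that(1,2)] that(3)
    unfolding a_kernel_def' by blast
  have "tl_relations n p \<subseteq> a_kernel (free_alg n) ?M (free_rep n p)"
  proof
    fix x :: "nat list \<Rightarrow> 'a" assume "x \<in> tl_relations n p"
    then consider
      (comm) i j where "x = word_monom 1 [i, j] \<ominus>\<^bsub>free_alg n\<^esub> word_monom 1 [j, i]"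
        "i \<in> {1..<n}" "j \<in> {1..<n}" "j + 2 \<le> i"
    | (braid) i j where "x = word_monom 1 [i, j, i] \<ominus>\<^bsub>free_alg n\<^esub> word_monom 1 [i]"
        "i \<in> {1..<n}" "j \<in> {1..<n}" "j = i + 1 \<or> i = j + 1"
    | (idem) i where "x = word_monom 1 [i, i] \<ominus>\<^bsub>free_alg n\<^esub> word_monom (of_nat p) [i]" "i \<in> {1..<n}"
      unfolding tl_relations_def by blast
    then show "x \<in> a_kernel (free_alg n) ?M (free_rep n p)"
    proof cases
      case comm
      have "word_mat n p [i, j] = (word_mat n p [j, i] :: 'a mat)"
        using comm assms(1) by (intro word_mat_comm) auto
      then show ?thesis
        unfolding comm(1) using comm
        by (intro minus word_monom_carrier) (simp_all add: free_rep_word_monom del: word_mat_Cons)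
    next
      case braid
      have "word_mat n p [i, j, i] = (word_mat n p [i] :: 'a mat)"
        using braid assms(1) by (intro word_mat_braid) auto
      then show ?thesis
        unfolding braid(1) using braid
        by (intro minus word_monom_carrier) (simp_all add: free_rep_word_monom del: word_mat_Cons)
    next
      case idem
      have "word_mat n p [i, i] = of_nat p \<cdot>\<^sub>m (word_mat n p [i] :: 'a mat)"
        using idem assms(1) by (intro word_mat_idem) auto
      moreover have "1 \<cdot>\<^sub>m A = A" for A :: "'a mat"
        by (rule eq_matI) auto
      ultimately show ?thesis
        unfolding idem(1) using idem
        by (intro minus word_monom_carrier) (simp_all add: free_rep_word_monom del: word_mat_Cons)
    qed
  qed
  then have "tl_ideal n p \<subseteq> a_kernel (free_alg n) ?M (free_rep n p)"
    unfolding tl_ideal_def by (rule h.R.genideal_minimal[OF h.kernel_is_ideal])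
  then have "free_rep n p f = \<zero>\<^bsub>?M\<^esub>"
    using assms(2) unfolding a_kernel_def' by blast
  then show ?thesis
    by (simp only: ring_mat_simps)
qed

lemma tl_class_eq_free_rep:
  assumes "p \<ge> 2" "f \<in> carrier (free_alg n)" "g \<in> carrier (free_alg n)"
    and "tl_class n p f = tl_class n p (g :: nat list \<Rightarrow> 'a::field)"
  shows "free_rep n p f = free_rep n p g"
proof -
  let ?M = "ring_mat TYPE('a) (p ^ n) ()"
  interpret h: ring_hom_ring "free_alg n" ?M "free_rep n p"
    by (rule free_rep_hom)
  have "f \<ominus>\<^bsub>free_alg n\<^esub> g \<in> tl_ideal n p"
    using assms tl_class_eq_iff by blast
  then have "free_rep n p (f \<ominus>\<^bsub>free_alg n\<^esub> g) = \<zero>\<^bsub>?M\<^esub>"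
    using tl_ideal_free_rep[OF assms(1)] by (simp only: ring_mat_simps)
  then show ?thesis
    using h.hom_minus_eq_zero_iff[OF assms(2,3)] by blast
qed

text \<open>Modulo the ideal \<open>f\<close> becomes a combination of normal forms with the same
  matrix, and independence of the patterns makes all its coefficients vanish.\<close>

lemma free_rep_faithful:
  assumes "p \<ge> 2" "n \<ge> 1" "f \<in> carrier (free_alg n)"
    and "free_rep n p f = (0\<^sub>m (p ^ n) (p ^ n) :: 'a::field mat)"
  shows "f \<in> tl_ideal n p"
proof -
  obtain c where c: "tl_class n p f = tl_class n p (nf_comb n c)"
    using tl_class_nf_comb[OF assms(3,2)] by blast
  then have "free_rep n p (nf_comb n c) = 0\<^sub>m (p ^ n) (p ^ n)"
    using tl_class_eq_free_rep[OF assms(1,3) nf_comb_carrier c] assms(4) by simp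
  then have zero: "(\<Sum>k\<in>nf_set n. c k * of_bool (nf_entry n p k a b)) = 0" if "a < p ^ n" "b < p ^ n" for a b
    using free_rep_nf_comb[OF assms(1) that, of c] that by simp
  have "c k = 0" if "k \<in> nf_set n" for k
  proof (rule nf_independent[OF finite_nf_set _ assms(1) nf_set_distinct zero that])
    show "is_nf n l" if "l \<in> nf_set n" for l
      using that by (simp add: nf_set_def)
  qed
  then have "nf_comb n c = \<zero>\<^bsub>free_alg n\<^esub>"
    by (simp add: nf_comb_def word_monom_def fun_eq_iff free_alg_simps)
  then have "tl_class n p f = tl_class n p \<zero>\<^bsub>free_alg n\<^esub>"
    using c by (simp only:)
  also have "\<dots> = \<zero>\<^bsub>tl_alg n p\<^esub>"
    by (rule ring_hom_zero[OF ring_hom_ring.homh[OF tl_class_hom] ring_free_alg ring_tl_alg])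
  finally show ?thesis
    using tl_class_eq_zero_iff[OF assms(3)] by blast
qed

text \<open>This turns \<open>tl_alg\<close> into the quotient by the kernel, so that the
  homomorphism theorem supplies the map in \<open>ex_brauer_rep\<close>.\<close>

lemma a_kernel_free_rep:
  assumes "p \<ge> 2" "n \<ge> 1"
  shows "a_kernel (free_alg n) (ring_mat TYPE('a::field) (p ^ n) ()) (free_rep n p) = tl_ideal n p"
proof -
  have "tl_ideal n p \<subseteq> carrier (free_alg n :: (nat list \<Rightarrow> 'a) ring)"
    using ideal.Icarr[OF tl_ideal_ideal] by blast
  then show ?thesis
    using tl_ideal_free_rep[OF assms(1)] free_rep_faithful[OF assms]
    unfolding a_kernel_def' ring_mat_simps by blast
qed

section \<open>Brauer's representation: existence, uniqueness, injectivity\<close>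

lemma tl_alg_carrier: "x \<in> carrier (tl_alg n p) \<longleftrightarrow> (\<exists>f\<in>carrier (free_alg n). x = tl_class n p f)"
  by (simp add: tl_alg_def FactRing_def A_RCOSETS_def' tl_class_def)

lemma ex_brauer_rep:
  assumes "p \<ge> 2" "n \<ge> 1"
  shows "\<exists>\<phi> :: (nat list \<Rightarrow> 'a::field) set \<Rightarrow> 'a mat. is_brauer_rep n p \<phi>"
proof -
  let ?M = "ring_mat TYPE('a) (p ^ n) ()"
  interpret h: ring_hom_ring "free_alg n" ?M "free_rep n p"
    by (rule free_rep_hom)
  \<comment> \<open>\<open>free_rep\<close> is constant on cosets of its kernel, and the map picks
    this common value.\<close>
  define \<phi> where "\<phi> X = the_elem (free_rep n p ` X)" for X :: "(nat list \<Rightarrow> 'a) set"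
  have \<phi>: "\<phi> (tl_class n p f) = free_rep n p f" if "f \<in> carrier (free_alg n)" for f
    using h.the_elem_simp[OF that] by (simp add: \<phi>_def tl_class_def a_kernel_free_rep[OF assms])
  have hom: "\<phi> \<in> ring_hom (tl_alg n p) ?M"
    using h.the_elem_hom unfolding tl_alg_def a_kernel_free_rep[OF assms] \<phi>_def .
  have "\<phi> (tl_smult n p c x) = c \<cdot>\<^sub>m \<phi> x" if x: "x \<in> carrier (tl_alg n p)" for c x
  proof -
    obtain f where f: "f \<in> carrier (free_alg n)" "x = tl_class n p f"
      using x tl_alg_carrier by blast
    have c: "word_monom c [] \<in> carrier (free_alg n)"
      by (rule word_monom_carrier) simp
    have "\<phi> (tl_smult n p c x) = free_rep n p (word_monom c []) * free_rep n p f"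
      using c f by (simp add: tl_smult_def \<phi> free_alg_mult_carrier free_rep_mult flip: tl_class_mult)
    also have "free_rep n p (word_monom c []) = c \<cdot>\<^sub>m 1\<^sub>m (p ^ n)"
      by (subst free_rep_word_monom) auto
    also have "(c \<cdot>\<^sub>m 1\<^sub>m (p ^ n)) * free_rep n p f = c \<cdot>\<^sub>m free_rep n p f"
      using free_rep_carrier[of n p f]
      by (simp add: mult_smult_assoc_mat[of _ "p ^ n" "p ^ n" _ "p ^ n"])
    finally show ?thesis
      using f \<phi> by simp
  qed
  moreover have "\<phi> (tl_gen n p i) = H_mat n p i" if i: "i \<in> {1..<n}" for i
  proof -
    have w: "[i] \<in> lists {1..<n}"
      using i by simp
    have "1 \<cdot>\<^sub>m A = A" for A :: "'a mat"
      by (rule eq_matI) auto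
    then have "\<phi> (tl_gen n p i) = word_mat n p [i]"
      by (simp add: tl_gen_def \<phi> word_monom_carrier[OF w] free_rep_word_monom[OF w] del: word_mat_Cons)
    also have "\<dots> = H_mat n p i"
      using i by (simp add: right_mult_one_mat[OF H_mat_dim])
    finally show ?thesis .
  qed
  ultimately show ?thesis
    unfolding is_brauer_rep_def using hom by blast
qed

text \<open>The values on generators fix everything: multiplicativity settles words, compatibility
  with scalars settles monomials, additivity the rest. Injectivity can then be read off from
  \<open>free_rep\<close>.\<close>

lemma brauer_rep_class:
  assumes \<phi>: "is_brauer_rep n p (\<phi> :: (nat list \<Rightarrow> 'a::field) set \<Rightarrow> 'a mat)"
    and f: "f \<in> carrier (free_alg n)"
  shows "\<phi> (tl_class n p f) = free_rep n p f"
proof -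
  let ?M = "ring_mat TYPE('a) (p ^ n) ()"
  have hom: "\<phi> \<in> ring_hom (tl_alg n p) ?M"
    and smult: "\<And>c x. x \<in> carrier (tl_alg n p) \<Longrightarrow> \<phi> (tl_smult n p c x) = c \<cdot>\<^sub>m \<phi> x"
    and gen: "\<And>i. i \<in> {1..<n} \<Longrightarrow> \<phi> (tl_gen n p i) = H_mat n p i"
    using \<phi> by (auto simp: is_brauer_rep_def)
  have cl: "tl_class n p f \<in> carrier (tl_alg n p)" if "f \<in> carrier (free_alg n)" for f :: "nat list \<Rightarrow> 'a"
    using that tl_alg_carrier by blast
  have one: "\<phi> (tl_class n p (word_monom 1 w)) = word_mat n p w" if "w \<in> lists {1..<n}" for w
    using that
  proof (induction w)
    case Nil
    have "tl_class n p (word_monom (1 :: 'a) []) = \<one>\<^bsub>tl_alg n p\<^esub>"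
      using ring_hom_one[OF ring_hom_ring.homh[OF tl_class_hom[of n p, where 'a = 'a]]] by (simp add: free_alg_simps)
    then show ?case
      using ring_hom_one[OF hom] by (simp add: ring_mat_simps)
  next
    case (Cons i w)
    then have i: "i \<in> {1..<n}" "[i] \<in> lists {1..<n}" and w: "w \<in> lists {1..<n}"
      by auto
    have "tl_class n p (word_monom (1 :: 'a) (i # w)) =
        tl_gen n p i \<otimes>\<^bsub>tl_alg n p\<^esub> tl_class n p (word_monom 1 w)"
      using tl_class_word_monom_append[OF i(2) w, of p 1 "1 :: 'a"] by (simp add: tl_gen_def)
    then have "\<phi> (tl_class n p (word_monom 1 (i # w))) = \<phi> (tl_gen n p i) * \<phi> (tl_class n p (word_monom 1 w))"
      using ring_hom_mult[OF hom, of "tl_gen n p i" "tl_class n p (word_monom 1 w)"]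
        cl[OF word_monom_carrier[OF w]] cl[OF word_monom_carrier[OF i(2)]]
      by (simp add: ring_mat_simps tl_gen_def)
    then show ?case
      using gen[OF i(1)] Cons.IH w by simp
  qed
  have monom: "\<phi> (tl_class n p (word_monom c w)) = free_rep n p (word_monom c w)" if w: "w \<in> lists {1..<n}" for c w
  proof -
    have "tl_class n p (word_monom c w) = tl_smult n p c (tl_class n p (word_monom 1 w))"
      using tl_class_word_monom_append[of "[]" n w p c 1] w by (simp add: tl_smult_def)
    then show ?thesis
      using smult[OF cl[OF word_monom_carrier[OF w]]] one[OF w] by (simp add: free_rep_word_monom[OF w])
  qed
  show ?thesis
    using f
  proof (induction rule: free_alg_induct)
    case zero
    have "(\<lambda>w. 0 :: 'a) = word_monom 0 []"
      by (simp add: word_monom_def fun_eq_iff)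
    then show ?case
      using monom[of "[]" 0] by simp
  next
    case (add f c w)
    then show ?case
      using ring_hom_add[OF hom cl cl, of f "word_monom c w"] monom[of w c]
      by (simp add: tl_class_add free_rep_add word_monom_carrier ring_mat_simps)
  qed
qed

lemma brauer_rep_inj:
  assumes "p \<ge> 2" "n \<ge> 1" "is_brauer_rep n p (\<phi> :: (nat list \<Rightarrow> 'a::field) set \<Rightarrow> 'a mat)"
  shows "inj_on \<phi> (carrier (tl_alg n p))"
proof (rule inj_onI)
  let ?M = "ring_mat TYPE('a) (p ^ n) ()"
  interpret h: ring_hom_ring "free_alg n" ?M "free_rep n p"
    by (rule free_rep_hom)
  fix x y assume "x \<in> carrier (tl_alg n p)" "y \<in> carrier (tl_alg n p)" and eq: "\<phi> x = \<phi> y"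
  then obtain f g where f: "f \<in> carrier (free_alg n)" "x = tl_class n p f"
    and g: "g \<in> carrier (free_alg n)" "y = tl_class n p g"
    using tl_alg_carrier by metis
  have "free_rep n p f = free_rep n p g"
    using eq brauer_rep_class[OF assms(3)] f g by simp
  then have "free_rep n p (f \<ominus>\<^bsub>free_alg n\<^esub> g) = \<zero>\<^bsub>?M\<^esub>"
    using h.hom_minus_eq_zero_iff[OF f(1) g(1)] by blast
  then have "f \<ominus>\<^bsub>free_alg n\<^esub> g \<in> tl_ideal n p"
    using h.R.minus_closed[OF f(1) g(1)] by (intro free_rep_faithful[OF assms(1,2)]) (simp_all only: ring_mat_simps)
  then show "x = y"
    using f g tl_class_eq_iff by blast
qed


section \<open>Separation and linear independence of the assigned matrices\<close>

lemma jones_nf: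
  assumes "t \<in> jones n" "n \<ge> 1"
  obtains k where "k \<in> nf_set n" "t = jones_class n (nf_word n k)"
proof -
  obtain w where w: "w \<in> lists {1..<n}" "t = jones_class n w"
    using assms(1) by (auto simp: jones_def jones_class_def quotient_def)
  obtain k0 where "is_nf n k0" "red w (nf_word n k0)"
    using red_nf[OF w(1) assms(2)] by blast
  then obtain k where k: "k \<in> nf_set n" "red w (nf_word n k)"
    using nf_set_normalize by metis
  have "(w, nf_word n k) \<in> jones_cong n"
    using red_jones_cong[OF k(2) w(1)] .
  then have "t = jones_class n (nf_word n k)"
    unfolding w(2) jones_class_def by (auto intro: jones_cong.trans jones_cong.sym)
  then show thesis
    using that k by blast
qed

lemma jones_mat_separated:
  assumes "t \<in> jones n" "n \<ge> 1" "p \<ge> 2"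
  shows "\<exists>a<p ^ n. \<exists>b<p ^ n. (jones_mat n p t :: 'a::field mat) $$ (a, b) = 1 \<and>
    (\<forall>t'. precedes n t' t \<longrightarrow> (jones_mat n p t' :: 'a mat) $$ (a, b) = 0)"
proof -
  obtain k where k: "k \<in> nf_set n" "t = jones_class n (nf_word n k)"
    using jones_nf[OF assms(1,2)] .
  then have nf: "is_nf n k"
    by (simp add: nf_set_def)
  obtain a b where ab: "a < p ^ n" "b < p ^ n" "nf_entry n p k a b"
    "\<And>k'. is_nf n k' \<Longrightarrow> lex_less n k' k \<Longrightarrow> \<not> nf_entry n p k' a b"
    using separating_entry[OF nf assms(3)] by blast
  have "(jones_mat n p t' :: 'a mat) $$ (a, b) = 0" if pre: "precedes n t' t" for t'
  proof -
    obtain k' l where kl: "is_nf n k'" "is_nf n l" "t' = jones_class n (nf_word n k')"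
      "t = jones_class n (nf_word n l)" "lex_less n k' l"
      using pre unfolding precedes_def lex_less_def by blast
    \<comment> \<open>\<open>precedes\<close> may witness the order with another exponent function
      \<open>l\<close> for \<open>t\<close>; by uniqueness it agrees with \<open>k\<close> at all
      indices that the order inspects.\<close>
    have "l i = k i" if "i \<in> {1..<n}" for i
      using nf_unique[OF kl(2) nf _ that] kl(4) k(2) by simp
    then have "lex_less n k' k"
      using kl(5) unfolding lex_less_def by auto
    then show ?thesis
      using ab kl by (simp add: jones_mat_nf_word[OF _ assms(3)])
  qed
  moreover have "(jones_mat n p t :: 'a mat) $$ (a, b) = 1"
    using ab k nf by (simp add: jones_mat_nf_word[OF _ assms(3)])
  ultimately show ?thesis
    using ab by blast
qed

lemma finsum_ring_mat_index:
  fixes f :: "'i \<Rightarrow> 'a::field mat"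
  assumes "finite S" "\<And>t. t \<in> S \<Longrightarrow> f t \<in> carrier_mat N N" "a < N" "b < N"
  shows "finsum (ring_mat TYPE('a) N ()) f S $$ (a, b) = (\<Sum>t\<in>S. f t $$ (a, b))"
proof -
  interpret ring "ring_mat TYPE('a) N ()"
    by (rule ring_mat)
  show ?thesis
    using assms(1,2)
  proof (induction S)
    case empty
    then show ?case
      using assms by (simp add: ring_mat_simps)
  next
    case (insert t S)
    have "finsum (ring_mat TYPE('a) N ()) f S \<in> carrier_mat N N"
      using finsum_closed[of f S] insert.prems by (auto simp: ring_mat_simps)
    then show ?case
      using insert assms by (subst finsum_insert) (auto simp: ring_mat_simps)
  qed
qed

lemma jones_mat_lin_indep:
  assumes "n \<ge> 1" "p \<ge> 2"
  shows "lin_indep_family (p ^ n) (jones n) (jones_mat n p :: nat list set \<Rightarrow> 'a::field mat)"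
  unfolding lin_indep_family_def
proof (intro allI impI, elim conjE)
  fix S and c :: "nat list set \<Rightarrow> 'a"
  assume S: "finite S" "S \<subseteq> jones n"
    and zero: "finsum (ring_mat TYPE('a) (p ^ n) ()) (\<lambda>t. c t \<cdot>\<^sub>m jones_mat n p t) S = 0\<^sub>m (p ^ n) (p ^ n)"
  have dims: "(jones_mat n p t :: 'a mat) \<in> carrier_mat (p ^ n) (p ^ n)" for t
    by (simp add: jones_mat_def rel_mat_def)
  have "\<forall>t\<in>S. \<exists>k. k \<in> nf_set n \<and> t = jones_class n (nf_word n k)"
    using jones_nf[OF _ assms(1)] S(2) by (metis subsetD)
  \<comment> \<open>Choosing exponent functions transfers the family of classes to
    \<open>nf_independent\<close>; \<open>K\<close> is injective because \<open>K t\<close>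
    determines \<open>t\<close>.\<close>
  then obtain K where K: "\<And>t. t \<in> S \<Longrightarrow> K t \<in> nf_set n" "\<And>t. t \<in> S \<Longrightarrow> t = jones_class n (nf_word n (K t))"
    by metis
  have inj: "inj_on K S"
    using K(2) by (metis inj_onI)
  define d where "d k = c (jones_class n (nf_word n k))" for k
  have d: "d (K t) = c t" if "t \<in> S" for t
    using K(2)[OF that] by (simp add: d_def)
  have sum0: "(\<Sum>k\<in>K ` S. d k * of_bool (nf_entry n p k a b)) = 0" if ab: "a < p ^ n" "b < p ^ n" for a b
  proof -
    have "(\<Sum>k\<in>K ` S. d k * of_bool (nf_entry n p k a b)) = (\<Sum>t\<in>S. (c t \<cdot>\<^sub>m jones_mat n p t) $$ (a, b))"
      unfolding sum.reindex[OF inj] o_def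
    proof (rule sum.cong[OF HOL.refl])
      fix t assume t: "t \<in> S"
      have "(jones_mat n p t :: 'a mat) $$ (a, b) = of_bool (nf_entry n p (K t) a b)"
        using jones_mat_nf_word[OF _ assms(2) ab, of "K t", where 'a = 'a] K[OF t] by (simp add: nf_set_def)
      then show "d (K t) * of_bool (nf_entry n p (K t) a b) = (c t \<cdot>\<^sub>m jones_mat n p t) $$ (a, b)"
        using d[OF t] ab carrier_matD[OF dims] by simp
    qed
    also have "\<dots> = finsum (ring_mat TYPE('a) (p ^ n) ()) (\<lambda>t. c t \<cdot>\<^sub>m jones_mat n p t) S $$ (a, b)"
      using S(1) dims ab by (intro finsum_ring_mat_index[symmetric]) auto
    finally show ?thesis
      using ab by (simp add: zero)
  qed
  have "d k = 0" if "k \<in> K ` S" for k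
  proof (rule nf_independent[OF finite_imageI[OF S(1)] _ assms(2) _ sum0 that])
    show "is_nf n l" if "l \<in> K ` S" for l
      using that K(1) by (auto simp: nf_set_def)
    show "\<exists>i\<in>{1..<n}. l i \<noteq> l' i" if "l \<in> K ` S" "l' \<in> K ` S" "l \<noteq> l'" for l l'
      using that K(1) by (intro nf_set_distinct) blast+
  qed
  then show "\<forall>t\<in>S. c t = 0"
    using d by force
qed

theorem mainTheorem2:
  fixes n p :: nat
  assumes "n \<ge> 2" and "p \<ge> 2" and "(of_nat p :: 'a::field) \<noteq> 0"
  shows "(\<forall>t\<in>jones n. \<exists>a<p ^ n. \<exists>b<p ^ n. (jones_mat n p t :: 'a mat) $$ (a, b) = 1 \<and>
            (\<forall>t'\<in>jones n. precedes n t' t \<longrightarrow> (jones_mat n p t' :: 'a mat) $$ (a, b) = 0)) \<and>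
         lin_indep_family (p ^ n) (jones n) (jones_mat n p :: nat list set \<Rightarrow> 'a mat) \<and>
         (\<exists>\<phi> :: (nat list \<Rightarrow> 'a) set \<Rightarrow> 'a mat. is_brauer_rep n p \<phi>) \<and>
         (\<forall>\<phi> :: (nat list \<Rightarrow> 'a) set \<Rightarrow> 'a mat. is_brauer_rep n p \<phi> \<longrightarrow>
            inj_on \<phi> (carrier (tl_alg n p)))"
proof (intro conjI ballI allI impI)
  have n: "n \<ge> 1"
    using assms(1) by simp
  show "\<exists>a<p ^ n. \<exists>b<p ^ n. (jones_mat n p t :: 'a mat) $$ (a, b) = 1 \<and>
      (\<forall>t'\<in>jones n. precedes n t' t \<longrightarrow> (jones_mat n p t' :: 'a mat) $$ (a, b) = 0)" if "t \<in> jones n" for t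
    using jones_mat_separated[OF that n assms(2), where 'a = 'a] by blast
  show "lin_indep_family (p ^ n) (jones n) (jones_mat n p :: nat list set \<Rightarrow> 'a mat)"
    by (rule jones_mat_lin_indep[OF n assms(2)])
  show "\<exists>\<phi> :: (nat list \<Rightarrow> 'a) set \<Rightarrow> 'a mat. is_brauer_rep n p \<phi>"
    by (rule ex_brauer_rep[OF assms(2) n])
  show "inj_on \<phi> (carrier (tl_alg n p))"
    if "is_brauer_rep n p \<phi>" for \<phi> :: "(nat list \<Rightarrow> 'a) set \<Rightarrow> 'a mat"
    by (rule brauer_rep_inj[OF assms(2) n that])
qed

end
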